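(* Let $A$ be a unital associative algebra over $\mathbb K$ and let $G$ be the group (under convolution $*$) of characters of $\overline T(T(A))$. For $L\in\operatorname{End}(T(A))$ (linear endomorphisms of $T(A)$) and $\Psi\in G$, set $$L^\Psi\coloneqq(L\otimes\Psi)\Delta_\prec^+\big|_{T(A)} .$$ Then $(\Psi,L)\mapsto L^\Psi$ defines a right action of $G$ on $\operatorname{End}(T(A))$.
   Context: $\mathbb K$ is a field of characteristic zero. $T(A)=\bigoplus_{n\ge1}A^{\otimes n}$, whose elements are written as words $a_1\cdots a_n=a_1\otimes\cdots\otimes a_n$; $\mathbf 1$ is the empty word. The double tensor algebra is $\overline T(T(A))=\mathbb K\mathbf 1\oplus\bigoplus_{k\ge1}T(A)^{\otimes k}$; its concatenation product is denoted by a vertical bar, $w_1|w_2$, with unit $\mathbf 1$. For $S=\{s_1<\dots<s_p\}\subseteq[n]=\{1,\dots,n\}$ put $a_S=a_{s_1}\cdots a_{s_p}$, $a_\emptyset=\mathbf 1$; $J^S_1,\dots,J^S_k$ denote the connected components of $[n]\setminus S$ (maximal sets of consecutive integers contained in $[n]\setminus S$), ordered increasingly by minimal element. The coproduct is given on words by $$\Delta(a_1\cdots a_n)=\sum_{S\subseteq[n]}a_S\otimes a_{J^S_1}|\cdots|a_{J^S_k}$$ (the second factor being $\mathbf 1$ when $S=[n]$), with $\Delta(\mathbf 1)=\mathbf 1\otimes\mathbf 1$, extended multiplicatively to $\overline T(T(A))$; this makes $\overline T(T(A))$ a connected graded Hopf algebra. The left half-coproduct on words is $$\Delta^+_\prec(a_1\cdots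 a_n)=\sum_{1\in S\subseteq[n]}a_S\otimes a_{J^S_1}|\cdots|a_{J^S_k}\in T(A)\otimes\overline T(T(A)).$$ Convolution of linear forms is $f*g=(f\otimes g)\Delta$; its unit is the counit $\varepsilon$, with $\varepsilon(\mathbf 1)=1$ and $\varepsilon$ vanishing on $T(T(A))$. A character is a unital multiplicative linear map $\overline T(T(A))\to\mathbb K$. We identify $V\otimes\mathbb K$ with $V$. *)

theory Defs
  imports Complex_Main "HOL-Algebra.Group" "HOL-Library.Function_Algebras"
begin

section \<open>Algebras and linear maps\<close>

text \<open>The sort \<open>{ring, monoid_mult}\<close> is that of associative rings with unit; unlike \<open>ring_1\<close> it
  does not exclude the zero ring.\<close>

locale unital_algebra = vector_space scale
  for scale :: "'k::field_char_0 \<Rightarrow> 'a::{ring,monoid_mult} \<Rightarrow> 'a" +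
  assumes scale_mult_left: "scale c x * y = scale c (x * y)"
    and scale_mult_right: "x * scale c y = scale c (x * y)"

definition fscale :: "'k::field \<Rightarrow> ('x \<Rightarrow> 'k) \<Rightarrow> 'x \<Rightarrow> 'k"
  where "fscale c f = (\<lambda>x. c * f x)"

text \<open>Linear maps between subspaces \<open>V\<close> and \<open>W\<close>. They are extensional (\<open>undefined\<close> outside \<open>V\<close>), so
  that equality of HOL functions is equality of maps on \<open>V\<close>.\<close>

definition linear_maps ::
  "('k::field \<Rightarrow> 'v::ab_group_add \<Rightarrow> 'v) \<Rightarrow> 'v set \<Rightarrow> ('k \<Rightarrow> 'w::ab_group_add \<Rightarrow> 'w) \<Rightarrow> 'w set \<Rightarrow> ('v \<Rightarrow> 'w) set"
  where "linear_maps s V t W =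
    {f \<in> V \<rightarrow>\<^sub>E W. (\<forall>x\<in>V. \<forall>y\<in>V. f (x + y) = f x + f y) \<and> (\<forall>c. \<forall>x\<in>V. f (s c x) = t c (f x))}"

section \<open>Tensors\<close>

text \<open>
  Tensors over a field are encoded through their pairing with multilinear forms: given a set \<open>M\<close> of
  scalar functions on a set of symbols (the multilinear, resp. bilinear, ones), the pure tensor with
  symbol \<open>p\<close> is evaluation at \<open>p\<close>, and the tensor space is the linear span of the pure tensors. (The
  guard \<open>\<phi> \<in> M\<close> makes two pure tensors equal as soon as all \<open>\<phi> \<in> M\<close> agree on them.) This is the
  quotient of the free vector space on the symbols by the multilinearity relations; the theorems
  \<open>tensor_alg_universal\<close> and \<open>tensor_prod_universal\<close> below give the usual universal properties, with
  values in an arbitrary vector space.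
\<close>

definition pure :: "('p \<Rightarrow> 'k::field) set \<Rightarrow> 'p \<Rightarrow> ('p \<Rightarrow> 'k) \<Rightarrow> 'k"
  where "pure M p = (\<lambda>\<phi>. if \<phi> \<in> M then \<phi> p else 0)"

text \<open>The linear map determined by its values \<open>F p\<close> on the pure tensors, for targets consisting of
  scalar functions (as all tensor spaces here do): see \<open>lift_pure\<close> and \<open>lift_linear\<close>.\<close>

definition lift :: "('p \<Rightarrow> 'x \<Rightarrow> 'k::field) \<Rightarrow> (('p \<Rightarrow> 'k) \<Rightarrow> 'k) \<Rightarrow> 'x \<Rightarrow> 'k"
  where "lift F t = (\<lambda>x. t (\<lambda>p. F p x))"

text \<open>Functions on lists over \<open>V\<close> that are linear in each entry, i.e. families of \<open>n\<close>-linear maps,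
  one for each \<open>n \<ge> 0\<close>.\<close>

definition multilinear_maps ::
  "('k::field \<Rightarrow> 'v::ab_group_add \<Rightarrow> 'v) \<Rightarrow> 'v set \<Rightarrow> ('k \<Rightarrow> 'w::ab_group_add \<Rightarrow> 'w) \<Rightarrow> ('v list \<Rightarrow> 'w) set"
  where "multilinear_maps s V t =
    {F. \<forall>xs\<in>lists V. \<forall>ys\<in>lists V. \<forall>u\<in>V.
          (\<forall>v\<in>V. F (xs @ (u + v) # ys) = F (xs @ u # ys) + F (xs @ v # ys)) \<and>
          (\<forall>c. F (xs @ s c u # ys) = t c (F (xs @ u # ys)))}"

definition bilinear_maps ::
  "('k::field \<Rightarrow> 'v::ab_group_add \<Rightarrow> 'v) \<Rightarrow> 'v set \<Rightarrow> ('k \<Rightarrow> 'w::ab_group_add \<Rightarrow> 'w) \<Rightarrow> 'w set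
    \<Rightarrow> ('k \<Rightarrow> 'u::ab_group_add \<Rightarrow> 'u) \<Rightarrow> ('v \<times> 'w \<Rightarrow> 'u) set"
  where "bilinear_maps s V t W r =
    {B. (\<forall>w\<in>W. \<forall>u\<in>V. (\<forall>v\<in>V. B (u + v, w) = B (u, w) + B (v, w)) \<and> (\<forall>c. B (s c u, w) = r c (B (u, w)))) \<and>
        (\<forall>v\<in>V. \<forall>u\<in>W. (\<forall>w\<in>W. B (v, u + w) = B (v, u) + B (v, w)) \<and> (\<forall>c. B (v, t c u) = r c (B (v, u))))}"

type_synonym ('v, 'k) tensors = "('v list \<Rightarrow> 'k) \<Rightarrow> 'k"
type_synonym ('v, 'w, 'k) tensors2 = "('v \<times> 'w \<Rightarrow> 'k) \<Rightarrow> 'k"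

text \<open>\<open>tensor s V [v\<^sub>1, \<dots>, v\<^sub>n]\<close> is \<open>v\<^sub>1 \<otimes> \<dots> \<otimes> v\<^sub>n\<close>, and \<open>tensor s V []\<close> is the unit; \<open>tensor_alg s V\<close> is the
  sum of the \<open>V\<^sup>\<otimes>\<^sup>n\<close> over \<open>n \<ge> 0\<close>, and \<open>tensor_alg_plus s V\<close> that over \<open>n \<ge> 1\<close>.\<close>

definition tensor :: "('k::field \<Rightarrow> 'v::ab_group_add \<Rightarrow> 'v) \<Rightarrow> 'v set \<Rightarrow> 'v list \<Rightarrow> ('v, 'k) tensors"
  where "tensor s V = pure (multilinear_maps s V (*))"

definition tensor_alg :: "('k::field \<Rightarrow> 'v::ab_group_add \<Rightarrow> 'v) \<Rightarrow> 'v set \<Rightarrow> ('v, 'k) tensors set"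
  where "tensor_alg s V = module.span fscale (tensor s V ` lists V)"

definition tensor_alg_plus :: "('k::field \<Rightarrow> 'v::ab_group_add \<Rightarrow> 'v) \<Rightarrow> 'v set \<Rightarrow> ('v, 'k) tensors set"
  where "tensor_alg_plus s V = module.span fscale (tensor s V ` (lists V - {[]}))"

definition tensor2 ::
  "('k::field \<Rightarrow> 'v::ab_group_add \<Rightarrow> 'v) \<Rightarrow> 'v set \<Rightarrow> ('k \<Rightarrow> 'w::ab_group_add \<Rightarrow> 'w) \<Rightarrow> 'w set \<Rightarrow> 'v \<times> 'w
    \<Rightarrow> ('v, 'w, 'k) tensors2"
  where "tensor2 s V t W = pure (bilinear_maps s V t W (*))"

definition tensor_prod ::
  "('k::field \<Rightarrow> 'v::ab_group_add \<Rightarrow> 'v) \<Rightarrow> 'v set \<Rightarrow> ('k \<Rightarrow> 'w::ab_group_add \<Rightarrow> 'w) \<Rightarrow> 'w set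
    \<Rightarrow> ('v, 'w, 'k) tensors2 set"
  where "tensor_prod s V t W = module.span fscale (tensor2 s V t W ` (V \<times> W))"

definition tensor_concat ::
  "('k::field \<Rightarrow> 'v::ab_group_add \<Rightarrow> 'v) \<Rightarrow> 'v set \<Rightarrow> ('v, 'k) tensors \<Rightarrow> ('v, 'k) tensors \<Rightarrow> ('v, 'k) tensors"
  where "tensor_concat s V x y = lift (\<lambda>xs. lift (\<lambda>ys. tensor s V (xs @ ys)) y) x"

section \<open>Universal properties\<close>

lemma vector_space_fscale: "vector_space (fscale :: 'k::field \<Rightarrow> ('x \<Rightarrow> 'k) \<Rightarrow> _)"
  by unfold_locales (auto simp: fscale_def fun_eq_iff algebra_simps)

lemma vector_space_times: "vector_space ((*) :: 'k::field \<Rightarrow> 'k \<Rightarrow> 'k)"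
  by unfold_locales (auto simp: algebra_simps)

lemma lift_pure:
  assumes "\<And>x. (\<lambda>p. F p x) \<in> M"
  shows "lift F (pure M p) = F p"
  using assms by (auto simp: lift_def pure_def fun_eq_iff)

lemma lift_linear: "lift F (x + y) = lift F x + lift F y" "lift F (fscale c x) = fscale c (lift F x)"
  by (auto simp: lift_def fscale_def fun_eq_iff)

lemma tensor_multilinear: "tensor s V \<in> multilinear_maps s V fscale"
  by (auto simp: tensor_def pure_def multilinear_maps_def fscale_def fun_eq_iff)

lemma tensor2_bilinear: "tensor2 s V t W \<in> bilinear_maps s V t W fscale"
  by (auto simp: tensor2_def pure_def bilinear_maps_def fscale_def fun_eq_iff)

lemma functionals_separate:
  assumes "vector_space (t :: 'k::field \<Rightarrow> 'w::ab_group_add \<Rightarrow> 'w)"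
    and "\<And>l. Vector_Spaces.linear t (*) l \<Longrightarrow> l x = l y"
  shows "x = y"
proof (rule ccontr)
  assume "x \<noteq> y"
  interpret vector_space_pair t "(*) :: 'k \<Rightarrow> 'k \<Rightarrow> 'k"
    using assms(1) vector_space_times by (simp add: vector_space_pair_def)
  have ind: "vs1.independent {x - y}"
    using \<open>x \<noteq> y\<close> by simp
  define l where "l = construct {x - y} (\<lambda>_. 1)"
  have lin: "Vector_Spaces.linear t (*) l"
    unfolding l_def by (rule linear_construct[OF ind])
  have "l (x - y) = 1"
    unfolding l_def by (rule construct_basis[OF ind]) simp
  moreover have "l (x - y) = l x - l y"
    using lin by (rule linear_diff)
  ultimately show False
    using assms(2)[OF lin] by simp
qed

lemma linear_mapsD:
  assumes "f \<in> linear_maps s V t W"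
  shows "x \<in> V \<Longrightarrow> f x \<in> W" "x \<in> V \<Longrightarrow> y \<in> V \<Longrightarrow> f (x + y) = f x + f y"
    "x \<in> V \<Longrightarrow> f (s c x) = t c (f x)" "x \<notin> V \<Longrightarrow> f x = undefined"
  using assms by (auto simp: linear_maps_def PiE_def extensional_def)

lemma span_pure_universal:
  fixes t :: "'k::field \<Rightarrow> 'w::ab_group_add \<Rightarrow> 'w" and F :: "'p \<Rightarrow> 'w" and M :: "('p \<Rightarrow> 'k) set"
  assumes t: "vector_space t"
    and F: "\<And>l. Vector_Spaces.linear t (*) l \<Longrightarrow> (\<lambda>p. l (F p)) \<in> M"
  shows "\<exists>!f. f \<in> linear_maps fscale (module.span fscale (pure M ` P)) t UNIV \<and> (\<forall>p\<in>P. f (pure M p) = F p)"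
proof -
  interpret vector_space_pair "fscale :: 'k \<Rightarrow> (('p \<Rightarrow> 'k) \<Rightarrow> 'k) \<Rightarrow> _" t
    using t vector_space_fscale by (simp add: vector_space_pair_def)
  let ?T = "vs1.span (pure M ` P)"
  obtain B where B: "B \<subseteq> pure M ` P" "vs1.independent B" "pure M ` P \<subseteq> vs1.span B"
    using vs1.maximal_independent_subset by blast
  define g where "g = construct B (\<lambda>b. F (SOME p. p \<in> P \<and> b = pure M p))"
  have lin: "Vector_Spaces.linear fscale t g"
    unfolding g_def by (rule linear_construct[OF B(2)])
  have eval: "l (g x) = x (\<lambda>p. l (F p))" if l: "Vector_Spaces.linear t (*) l" and x: "x \<in> vs1.span B" for l x
  proof -
    interpret sc: vector_space_pair "fscale :: 'k \<Rightarrow> (('p \<Rightarrow> 'k) \<Rightarrow> 'k) \<Rightarrow> _" "(*) :: 'k \<Rightarrow> 'k \<Rightarrow> 'k"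
      using vector_space_times vector_space_fscale by (simp add: vector_space_pair_def)
    show ?thesis
    proof (rule sc.linear_eq_on[OF _ _ x, where f = "\<lambda>x. l (g x)" and g = "\<lambda>x. x (\<lambda>p. l (F p))"])
      show "Vector_Spaces.linear fscale (*) (\<lambda>x. l (g x))"
        using Vector_Spaces.linear_compose[OF lin l] by (simp add: comp_def)
      show "Vector_Spaces.linear fscale (*) (\<lambda>x. x (\<lambda>p. l (F p)))"
        by unfold_locales (auto simp: fscale_def fun_eq_iff algebra_simps)
      fix b assume b: "b \<in> B"
      then have ex: "\<exists>p. p \<in> P \<and> b = pure M p"
        using B(1) by blast
      define p where "p = (SOME p. p \<in> P \<and> b = pure M p)"
      have p: "b = pure M p"
        using someI_ex[OF ex] by (simp add: p_def)
      have "g b = F p"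
        unfolding g_def by (simp add: construct_basis[OF B(2) b] p_def)
      then show "l (g b) = b (\<lambda>p. l (F p))"
        using F[OF l] by (simp add: p pure_def)
    qed
  qed
  have val: "g (pure M p) = F p" if "p \<in> P" for p
  proof (rule functionals_separate[OF t])
    fix l assume l: "Vector_Spaces.linear t (*) l"
    show "l (g (pure M p)) = l (F p)"
      using eval[OF l, of "pure M p"] F[OF l] B(3) that by (auto simp: pure_def)
  qed
  interpret gl: Vector_Spaces.linear fscale t g by (rule lin)
  let ?f = "restrict g ?T"
  have f: "?f \<in> linear_maps fscale ?T t UNIV \<and> (\<forall>p\<in>P. ?f (pure M p) = F p)"
    by (auto simp: linear_maps_def vs1.span_add vs1.span_scale gl.add gl.scale vs1.span_base val)
  moreover have "f = ?f" if "f \<in> linear_maps fscale ?T t UNIV \<and> (\<forall>p\<in>P. f (pure M p) = F p)" for f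
  proof
    fix x
    have fl: "f \<in> linear_maps fscale ?T t UNIV" and fp: "\<And>p. p \<in> P \<Longrightarrow> f (pure M p) = F p"
      using that by auto
    show "f x = ?f x"
    proof (cases "x \<in> ?T")
      case True
      have "x \<in> ?T \<and> f x = g x"
      proof (rule vs1.span_induct_alt[OF True, where h = "\<lambda>x. x \<in> ?T \<and> f x = g x"])
        have "f (fscale 0 0) = t 0 (f 0)"
          by (rule linear_mapsD(3)[OF fl]) (rule vs1.span_zero)
        then have "f 0 = 0" by simp
        with gl.zero vs1.span_zero[of "pure M ` P"] show "0 \<in> ?T \<and> f 0 = g 0" by metis
      next
        fix c x y assume x: "x \<in> pure M ` P" and y: "y \<in> ?T \<and> f y = g y"
        then obtain p where p: "p \<in> P" "x = pure M p" by blast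
        have T: "x \<in> ?T" "fscale c x \<in> ?T" "fscale c x + y \<in> ?T"
          using x y vs1.span_base vs1.span_scale vs1.span_add by metis+
        have "f (fscale c x + y) = t c (f x) + f y"
          using linear_mapsD(2)[OF fl T(2), of y] linear_mapsD(3)[OF fl T(1), of c] y by metis
        also have "\<dots> = t c (g x) + g y"
          using p y fp val by metis
        also have "\<dots> = g (fscale c x + y)"
          using gl.add gl.scale by metis
        finally show "fscale c x + y \<in> ?T \<and> f (fscale c x + y) = g (fscale c x + y)"
          using T by blast
      qed
      then show ?thesis by simp
    qed (use linear_mapsD(4)[OF fl] in auto)
  qed
  ultimately show ?thesis by blast
qed

theorem tensor_alg_universal:
  assumes "vector_space t" "F \<in> multilinear_maps s V t"
  shows "\<exists>!f. f \<in> linear_maps fscale (tensor_alg s V) t UNIV \<and> (\<forall>xs\<in>lists V. f (tensor s V xs) = F xs)"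
  unfolding tensor_alg_def tensor_def
proof (rule span_pure_universal[OF assms(1)])
  fix l assume "Vector_Spaces.linear t (*) l"
  then interpret Vector_Spaces.linear t "(*)" l .
  show "(\<lambda>p. l (F p)) \<in> multilinear_maps s V (*)"
    using assms(2) by (auto simp: multilinear_maps_def add scale)
qed

theorem tensor_prod_universal:
  assumes "vector_space r" "B \<in> bilinear_maps s V t W r"
  shows "\<exists>!f. f \<in> linear_maps fscale (tensor_prod s V t W) r UNIV \<and>
    (\<forall>v\<in>V. \<forall>w\<in>W. f (tensor2 s V t W (v, w)) = B (v, w))"
proof -
  have "\<exists>!f. f \<in> linear_maps fscale (tensor_prod s V t W) r UNIV \<and>
      (\<forall>p\<in>V \<times> W. f (tensor2 s V t W p) = B p)"
    unfolding tensor_prod_def tensor2_def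
  proof (rule span_pure_universal[OF assms(1)])
    fix l assume "Vector_Spaces.linear r (*) l"
    then interpret Vector_Spaces.linear r "(*)" l .
    show "(\<lambda>p. l (B p)) \<in> bilinear_maps s V t W (*)"
      using assms(2) by (auto simp: bilinear_maps_def add scale)
  qed
  then show ?thesis by simp
qed

lemma multilinear_mapsD:
  assumes "F \<in> multilinear_maps s V t" "xs \<in> lists V" "ys \<in> lists V" "u \<in> V"
  shows "v \<in> V \<Longrightarrow> F (xs @ (u + v) # ys) = F (xs @ u # ys) + F (xs @ v # ys)"
    "F (xs @ s c u # ys) = t c (F (xs @ u # ys))"
  using assms by (auto simp: multilinear_maps_def)

lemma multilinear_mapsI:
  assumes "\<And>xs ys u v. xs \<in> lists V \<Longrightarrow> ys \<in> lists V \<Longrightarrow> u \<in> V \<Longrightarrow> v \<in> V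
      \<Longrightarrow> F (xs @ (u + v) # ys) = F (xs @ u # ys) + F (xs @ v # ys)"
    and "\<And>xs ys u c. xs \<in> lists V \<Longrightarrow> ys \<in> lists V \<Longrightarrow> u \<in> V \<Longrightarrow> F (xs @ s c u # ys) = t c (F (xs @ u # ys))"
  shows "F \<in> multilinear_maps s V t"
  using assms by (auto simp: multilinear_maps_def)

lemma tensor_concat_tensor:
  assumes V: "\<And>u v. u \<in> V \<Longrightarrow> v \<in> V \<Longrightarrow> u + v \<in> V" "\<And>c u. u \<in> V \<Longrightarrow> s c u \<in> V"
    and xs: "xs \<in> lists V" and ys: "ys \<in> lists V"
  shows "tensor_concat s V (tensor s V xs) (tensor s V ys) = tensor s V (xs @ ys)"
proof -
  let ?M = "multilinear_maps s V (*)"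
  note D = multilinear_mapsD[OF tensor_multilinear[of s V]]
  have right: "(\<lambda>zs. tensor s V (us @ zs) \<phi>) \<in> ?M" if "us \<in> lists V" for us \<phi>
  proof (rule multilinear_mapsI)
    fix as bs u v c assume *: "as \<in> lists V" "bs \<in> lists V" "u \<in> V"
    then have "us @ as \<in> lists V" using that by simp
    note D' = D[OF this *(2,3)]
    show "tensor s V (us @ as @ s c u # bs) \<phi> = c * tensor s V (us @ as @ u # bs) \<phi>"
      using D'(2)[of c] by (simp add: fscale_def)
    show "tensor s V (us @ as @ (u + v) # bs) \<phi> = tensor s V (us @ as @ u # bs) \<phi> + tensor s V (us @ as @ v # bs) \<phi>"
      if "v \<in> V" using fun_cong[OF D'(1)[OF that], of \<phi>] by simp
  qed
  let ?G = "\<lambda>us. lift (\<lambda>zs. tensor s V (us @ zs)) (tensor s V ys)"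
  have inner: "?G us = tensor s V (us @ ys)" if "us \<in> lists V" for us
    unfolding tensor_def by (rule lift_pure) (use right[OF that] in \<open>simp add: tensor_def\<close>)
  have inner': "?G (as @ u # bs) = tensor s V (as @ u # bs @ ys)"
    if "as \<in> lists V" "u \<in> V" "bs \<in> lists V" for as u bs
    using inner[of "as @ u # bs"] that by simp
  have left: "(\<lambda>us. ?G us \<phi>) \<in> ?M" for \<phi>
  proof (rule multilinear_mapsI)
    fix as bs u v c assume *: "as \<in> lists V" "bs \<in> lists V" "u \<in> V"
    have "bs @ ys \<in> lists V" using * ys by simp
    note D' = D[OF *(1) this *(3)]
    show "?G (as @ s c u # bs) \<phi> = c * ?G (as @ u # bs) \<phi>"
      using D'(2)[of c] * V by (simp add: fscale_def inner'[simplified])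
    show "?G (as @ (u + v) # bs) \<phi> = ?G (as @ u # bs) \<phi> + ?G (as @ v # bs) \<phi>"
      if "v \<in> V" using * V that fun_cong[OF D'(1)[OF that], of \<phi>] by (simp add: inner'[simplified])
  qed
  have "tensor_concat s V (tensor s V xs) (tensor s V ys) = ?G xs"
    unfolding tensor_concat_def by (subst (3) tensor_def, rule lift_pure, rule left)
  then show ?thesis
    using inner[OF xs] by simp
qed

section \<open>The double tensor algebra\<close>

text \<open>From here on \<open>s\<close> is the scalar multiplication of \<open>A\<close>, and \<open>A\<close> is the whole type \<open>'a\<close>.\<close>

type_synonym ('a, 'k) TA = "('a, 'k) tensors"
type_synonym ('a, 'k) TTA = "(('a, 'k) TA, 'k) tensors"

abbreviation TA :: "('k::field \<Rightarrow> 'a::ab_group_add \<Rightarrow> 'a) \<Rightarrow> ('a, 'k) TA set"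
  where "TA s \<equiv> tensor_alg_plus s UNIV"

abbreviation word :: "('k::field \<Rightarrow> 'a::ab_group_add \<Rightarrow> 'a) \<Rightarrow> 'a list \<Rightarrow> ('a, 'k) TA"
  where "word s as \<equiv> tensor s UNIV as"

abbreviation TTA :: "('k::field \<Rightarrow> 'a::ab_group_add \<Rightarrow> 'a) \<Rightarrow> ('a, 'k) TTA set"
  where "TTA s \<equiv> tensor_alg fscale (TA s)"

abbreviation bars :: "('k::field \<Rightarrow> 'a::ab_group_add \<Rightarrow> 'a) \<Rightarrow> ('a, 'k) TA list \<Rightarrow> ('a, 'k) TTA"
  where "bars s ws \<equiv> tensor fscale (TA s) ws"

abbreviation bar :: "('k::field \<Rightarrow> 'a::ab_group_add \<Rightarrow> 'a) \<Rightarrow> ('a, 'k) TTA \<Rightarrow> ('a, 'k) TTA \<Rightarrow> ('a, 'k) TTA"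
  where "bar s \<equiv> tensor_concat fscale (TA s)"

abbreviation TTA_one :: "('k::field \<Rightarrow> 'a::ab_group_add \<Rightarrow> 'a) \<Rightarrow> ('a, 'k) TTA"
  where "TTA_one s \<equiv> bars s []"

abbreviation TTA_pair ::
  "('k::field \<Rightarrow> 'a::ab_group_add \<Rightarrow> 'a) \<Rightarrow> ('a, 'k) TTA \<times> ('a, 'k) TTA \<Rightarrow> (('a, 'k) TTA, ('a, 'k) TTA, 'k) tensors2"
  where "TTA_pair s \<equiv> tensor2 fscale (TTA s) fscale (TTA s)"

definition TTA_pair_mult ::
  "('k::field \<Rightarrow> 'a::ab_group_add \<Rightarrow> 'a) \<Rightarrow> (('a, 'k) TTA, ('a, 'k) TTA, 'k) tensors2
    \<Rightarrow> (('a, 'k) TTA, ('a, 'k) TTA, 'k) tensors2 \<Rightarrow> (('a, 'k) TTA, ('a, 'k) TTA, 'k) tensors2"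
  where "TTA_pair_mult s X Y =
    lift (\<lambda>(x, y). lift (\<lambda>(x', y'). TTA_pair s (bar s x x', bar s y y')) Y) X"

section \<open>Coproduct and left half-coproduct\<close>

text \<open>Positions in a word are numbered from \<open>0\<close> (as in \<^const>\<open>nths\<close>), so \<open>[n]\<close> is \<open>{..<n}\<close>, the
  condition \<open>1 \<in> S\<close> reads \<open>0 \<in> S\<close>, and \<open>a\<^sub>S\<close> has letters \<open>nths as S\<close>.\<close>

definition components :: "nat set \<Rightarrow> nat set set"
  where "components X =
    {J. J \<noteq> {} \<and> J \<subseteq> X \<and> (\<exists>i j. J = {i..j}) \<and> (\<forall>i j. J \<subseteq> {i..j} \<and> {i..j} \<subseteq> X \<longrightarrow> {i..j} = J)}"

definition component_list :: "nat set \<Rightarrow> nat set list"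
  where "component_list X = sorted_key_list_of_set Min (components X)"

definition remaining_words :: "('k::field \<Rightarrow> 'a::ab_group_add \<Rightarrow> 'a) \<Rightarrow> 'a list \<Rightarrow> nat set \<Rightarrow> ('a, 'k) TTA"
  where "remaining_words s as S =
    bars s (map (\<lambda>J. word s (nths as J)) (component_list ({..<length as} - S)))"

text \<open>The subword \<open>a\<^sub>S\<close> as an element of the double tensor algebra, where \<open>a\<^sub>\<emptyset>\<close> is the unit (which is
  not the one-entry tensor on the empty word).\<close>

definition subword :: "('k::field \<Rightarrow> 'a::ab_group_add \<Rightarrow> 'a) \<Rightarrow> 'a list \<Rightarrow> nat set \<Rightarrow> ('a, 'k) TTA"
  where "subword s as S = (if S = {} then TTA_one s else bars s [word s (nths as S)])"

definition coproduct_word ::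
  "('k::field \<Rightarrow> 'a::ab_group_add \<Rightarrow> 'a) \<Rightarrow> 'a list \<Rightarrow> (('a, 'k) TTA, ('a, 'k) TTA, 'k) tensors2"
  where "coproduct_word s as =
    (\<Sum>S\<in>Pow {..<length as}. TTA_pair s (subword s as S, remaining_words s as S))"

text \<open>Linear in each word, and multiplicative: \<open>\<Delta>(w\<^sub>1|\<dots>|w\<^sub>k) = \<Delta>(w\<^sub>1)\<cdots>\<Delta>(w\<^sub>k)\<close>.\<close>

definition coproduct ::
  "('k::field \<Rightarrow> 'a::ab_group_add \<Rightarrow> 'a) \<Rightarrow> ('a, 'k) TTA \<Rightarrow> (('a, 'k) TTA, ('a, 'k) TTA, 'k) tensors2"
  where "coproduct s = lift (\<lambda>ws.
    foldr (TTA_pair_mult s) (map (lift (coproduct_word s)) ws) (TTA_pair s (TTA_one s, TTA_one s)))"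

definition left_half_coproduct ::
  "('k::field \<Rightarrow> 'a::ab_group_add \<Rightarrow> 'a) \<Rightarrow> ('a, 'k) TA \<Rightarrow> (('a, 'k) TA, ('a, 'k) TTA, 'k) tensors2"
  where "left_half_coproduct s = lift (\<lambda>as.
    \<Sum>S\<in>{S \<in> Pow {..<length as}. 0 \<in> S}.
      tensor2 fscale (TA s) fscale (TTA s) (word s (nths as S), remaining_words s as S))"

section \<open>Characters, convolution and the operation on endomorphisms\<close>

definition characters :: "('k::field \<Rightarrow> 'a::ab_group_add \<Rightarrow> 'a) \<Rightarrow> (('a, 'k) TTA \<Rightarrow> 'k) set"
  where "characters s =
    {\<Psi> \<in> linear_maps fscale (TTA s) (*) UNIV.
       \<Psi> (TTA_one s) = 1 \<and> (\<forall>x\<in>TTA s. \<forall>y\<in>TTA s. \<Psi> (bar s x y) = \<Psi> x * \<Psi> y)}"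

text \<open>Applying a tensor to the bilinear form \<open>(x, y) \<mapsto> f x * g y\<close> is applying \<open>f \<otimes> g\<close> to it, with
  values in \<open>\<bbbK> \<otimes> \<bbbK> = \<bbbK>\<close>.\<close>

definition convolution ::
  "('k::field \<Rightarrow> 'a::ab_group_add \<Rightarrow> 'a) \<Rightarrow> (('a, 'k) TTA \<Rightarrow> 'k) \<Rightarrow> (('a, 'k) TTA \<Rightarrow> 'k) \<Rightarrow> ('a, 'k) TTA \<Rightarrow> 'k"
  where "convolution s f g = restrict (\<lambda>x. coproduct s x (\<lambda>(u, v). f u * g v)) (TTA s)"

text \<open>The pairing with the form that is \<open>1\<close> on the empty list and \<open>0\<close> on all others.\<close>

definition counit :: "('k::field \<Rightarrow> 'a::ab_group_add \<Rightarrow> 'a) \<Rightarrow> ('a, 'k) TTA \<Rightarrow> 'k"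
  where "counit s = restrict (\<lambda>x. x (\<lambda>ws. if ws = [] then 1 else 0)) (TTA s)"

definition character_group :: "('k::field \<Rightarrow> 'a::ab_group_add \<Rightarrow> 'a) \<Rightarrow> (('a, 'k) TTA \<Rightarrow> 'k) monoid"
  where "character_group s = \<lparr>carrier = characters s, mult = convolution s, one = counit s\<rparr>"

abbreviation End_TA :: "('k::field \<Rightarrow> 'a::ab_group_add \<Rightarrow> 'a) \<Rightarrow> (('a, 'k) TA \<Rightarrow> ('a, 'k) TA) set"
  where "End_TA s \<equiv> linear_maps fscale (TA s) fscale (TA s)"

text \<open>\<open>(L \<otimes> \<Psi>)\<Delta>\<^sup>+\<^sub>\<prec>\<close>; the identification of \<open>V \<otimes> \<bbbK>\<close> with \<open>V\<close> turns \<open>L u \<otimes> \<Psi> h\<close> into \<open>\<Psi> h \<cdot> L u\<close>.\<close>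

definition char_act ::
  "('k::field \<Rightarrow> 'a::ab_group_add \<Rightarrow> 'a) \<Rightarrow> (('a, 'k) TTA \<Rightarrow> 'k) \<Rightarrow> (('a, 'k) TA \<Rightarrow> ('a, 'k) TA)
    \<Rightarrow> ('a, 'k) TA \<Rightarrow> ('a, 'k) TA"
  where "char_act s \<Psi> L =
    restrict (\<lambda>x. lift (\<lambda>(u, h). fscale (\<Psi> h) (L u)) (left_half_coproduct s x)) (TA s)"

locale right_group_action = group G for G (structure) +
  fixes E :: "'e set" and act :: "'g \<Rightarrow> 'e \<Rightarrow> 'e"
  assumes act_closed: "g \<in> carrier G \<Longrightarrow> x \<in> E \<Longrightarrow> act g x \<in> E"
    and act_one: "x \<in> E \<Longrightarrow> act \<one> x = x"
    and act_mult: "g \<in> carrier G \<Longrightarrow> h \<in> carrier G \<Longrightarrow> x \<in> E \<Longrightarrow> act (g \<otimes> h) x = act h (act g x)"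

end

theory Submission
  imports Defs
begin

text \<open>
  Regard a scalar function \<open>f\<close> on words as the noncommutative power series \<open>\<Sum>\<^sub>w f(w) w\<close>. The proof
  replaces characters and endomorphisms by such series and shows that the operation
  \<open>L \<mapsto> L\<^sup>\<Psi>\<close> is substitution of \<open>a \<psi>\<close> for every letter \<open>a\<close>.

  A character \<open>\<Psi>\<close> is determined by its values \<open>\<psi>(w)\<close> on single words, to which \<open>\<psi>([]) = 1\<close> is
  added; conversely, every multilinear \<open>\<psi>\<close> with \<open>\<psi>([]) = 1\<close> comes from a character
  (\<open>character_of_word_values\<close>, \<open>word_values_character_of\<close>). A subset \<open>S\<close> of positions of a word that
  contains the first one is the same as a factorization of the word into \<open>b\<^sub>1 g\<^sub>1 \<cdots> b\<^sub>k g\<^sub>k\<close>, where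
  \<open>b\<^sub>1 \<cdots> b\<^sub>k\<close> is the chosen subword and the nonempty gaps among the \<open>g\<^sub>i\<close> are the words on the
  connected components of the complement. As \<open>\<psi>([]) = 1\<close>, empty gaps may be included, so
  each coordinate of \<open>L\<^sup>\<Psi>\<close> on a word is the sum of \<open>L(b\<^sub>1 \<cdots> b\<^sub>k) \<psi>(g\<^sub>1) \<cdots> \<psi>(g\<^sub>k)\<close> over all such
  factorizations. This is the coefficient in the series \<open>\<sigma>\<^sub>\<psi>(L)\<close> that results from \<open>L\<close> by the
  substitution \<open>a \<mapsto> a \<psi>\<close> (\<open>char_act_word\<close>). In a convolution there may also be a gap in front, so
  \<open>\<Psi> * \<Phi>\<close> has the series \<open>\<phi> \<sigma>\<^sub>\<phi>(\<psi>)\<close> (\<open>word_values_convolution\<close>).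

  A substitution is a morphism of algebras. Hence \<open>\<sigma>\<^sub>\<phi> \<circ> \<sigma>\<^sub>\<psi>\<close> sends \<open>a\<close> to \<open>\<sigma>\<^sub>\<phi>(a \<psi>) = a \<phi> \<sigma>\<^sub>\<phi>(\<psi>)\<close>, so it
  is the substitution that belongs to \<open>\<Psi> * \<Phi>\<close>: this is the action property
  (\<open>gap_subst_gap_subst\<close>), and associativity of the convolution follows in the same way
  (\<open>gap_conv_assoc\<close>). Inverses of characters exist because \<open>\<chi> \<mapsto> \<phi> \<sigma>\<^sub>\<phi>(\<chi>)\<close> is unitriangular with
  respect to the length of words (\<open>gap_conv_left_inverse\<close>).
\<close>

section \<open>Substitution in noncommutative power series\<close>

text \<open>The product of noncommutative power series: dually, convolution with respect to deconcatenation.\<close>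

definition cauchy_prod :: "('a list \<Rightarrow> 'k) \<Rightarrow> ('a list \<Rightarrow> 'k) \<Rightarrow> 'a list \<Rightarrow> 'k::comm_ring_1"
  where "cauchy_prod f g as = (\<Sum>k\<le>length as. f (take k as) * g (drop k as))"

lemma cauchy_prod_Nil: "cauchy_prod f g [] = f [] * g []"
  by (simp add: cauchy_prod_def)

lemma cauchy_prod_Cons: "cauchy_prod f g (a # as) = f [] * g (a # as) + cauchy_prod (\<lambda>p. f (a # p)) g as"
  by (simp add: cauchy_prod_def sum.atMost_Suc_shift del: sum.atMost_Suc)

text \<open>The values of a product on words of bounded length depend only on the values of the factors on such
  words. This is what lets an induction hypothesis about shorter words be used inside a product.\<close>

lemma cauchy_prod_cong:
  assumes "\<And>p. length p \<le> length as \<Longrightarrow> f p = f' p" "\<And>p. length p \<le> length as \<Longrightarrow> g p = g' p"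
  shows "cauchy_prod f g as = cauchy_prod f' g' as"
  using assms by (simp add: cauchy_prod_def)

lemma cauchy_prod_add_left: "cauchy_prod (\<lambda>p. f p + f' p) g as = cauchy_prod f g as + cauchy_prod f' g as"
  and cauchy_prod_add_right: "cauchy_prod f (\<lambda>p. g p + g' p) as = cauchy_prod f g as + cauchy_prod f g' as"
  and cauchy_prod_scale_left: "cauchy_prod (\<lambda>p. c * f p) g as = c * cauchy_prod f g as"
  and cauchy_prod_scale_right: "cauchy_prod f (\<lambda>p. c * g p) as = c * cauchy_prod f g as"
  by (simp_all add: cauchy_prod_def sum.distrib sum_distrib_left algebra_simps)

lemma cauchy_prod_assoc: "cauchy_prod (cauchy_prod f g) h as = cauchy_prod f (cauchy_prod g h) as"
proof (induction "as" arbitrary: f)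
  case (Cons a as)
  show ?case
    by (simp add: cauchy_prod_Cons cauchy_prod_Nil Cons.IH cauchy_prod_add_left cauchy_prod_scale_left algebra_simps)
qed (simp add: cauchy_prod_Nil algebra_simps)

definition unit_word :: "'a list \<Rightarrow> 'k::comm_ring_1"
  where "unit_word as = (if as = [] then 1 else 0)"

lemma cauchy_prod_unit_left: "cauchy_prod unit_word g as = g as"
proof (cases "as")
  case (Cons a bs)
  show ?thesis by (simp add: Cons cauchy_prod_Cons unit_word_def) (simp add: cauchy_prod_def)
qed (simp add: cauchy_prod_Nil unit_word_def)

lemma cauchy_prod_unit_right: "cauchy_prod f unit_word as = f as"
proof (induction "as" arbitrary: f)
  case (Cons a as)
  show ?case by (simp add: cauchy_prod_Cons Cons.IH) (simp add: unit_word_def)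
qed (simp add: cauchy_prod_Nil unit_word_def)

text \<open>The coefficients of the series that results from \<open>L\<close> by the substitution \<open>a \<mapsto> a \<phi>\<close>. The recursion splits
  off the first letter \<open>a\<close>, which must be a chosen one, and the gap behind it; the remaining chosen
  letters are collected in the argument of \<open>L\<close>.\<close>

fun gap_subst :: "('a list \<Rightarrow> 'k) \<Rightarrow> ('a list \<Rightarrow> 'k) \<Rightarrow> 'a list \<Rightarrow> 'k::comm_ring_1" where
  "gap_subst L \<phi> [] = L []"
| "gap_subst L \<phi> (a # as) =
    (\<Sum>k\<le>length as. \<phi> (take k as) * gap_subst (\<lambda>p. L (a # p)) \<phi> (drop k as))"

text \<open>The series \<open>\<phi> \<sigma>\<^sub>\<phi>(L)\<close>, in which there may be a gap in front of the first chosen letter as well.\<close>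

definition gap_conv :: "('a list \<Rightarrow> 'k) \<Rightarrow> ('a list \<Rightarrow> 'k) \<Rightarrow> 'a list \<Rightarrow> 'k::comm_ring_1"
  where "gap_conv L \<phi> = cauchy_prod \<phi> (gap_subst L \<phi>)"

lemma gap_subst_Cons: "gap_subst L \<phi> (a # as) = gap_conv (\<lambda>p. L (a # p)) \<phi> as"
  by (simp add: gap_conv_def cauchy_prod_def)

text \<open>From here on a substitution is unfolded only by \<open>gap_subst_Cons\<close>, so that the explicit sum does not
  appear.\<close>

declare gap_subst.simps(2) [simp del]

lemma gap_subst_add: "gap_subst (\<lambda>p. L p + M p) \<phi> as = gap_subst L \<phi> as + gap_subst M \<phi> as"
proof (induction "as" arbitrary: L M rule: length_induct)
  case (1 "as")
  show ?case
  proof (cases "as")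
    case (Cons a bs)
    have "gap_conv (\<lambda>p. L (a # p) + M (a # p)) \<phi> bs =
        cauchy_prod \<phi> (\<lambda>p. gap_subst (\<lambda>p. L (a # p)) \<phi> p + gap_subst (\<lambda>p. M (a # p)) \<phi> p) bs"
      unfolding gap_conv_def using 1 Cons by (intro cauchy_prod_cong) auto
    then show ?thesis
      by (simp add: Cons gap_subst_Cons cauchy_prod_add_right) (simp add: gap_conv_def)
  qed simp
qed

lemma gap_subst_scale: "gap_subst (\<lambda>p. c * L p) \<phi> as = c * gap_subst L \<phi> as"
proof (induction "as" arbitrary: L rule: length_induct)
  case (1 "as")
  show ?case
  proof (cases "as")
    case (Cons a bs)
    have "gap_conv (\<lambda>p. c * L (a # p)) \<phi> bs = cauchy_prod \<phi> (\<lambda>p. c * gap_subst (\<lambda>p. L (a # p)) \<phi> p) bs"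
      unfolding gap_conv_def using 1 Cons by (intro cauchy_prod_cong) auto
    then show ?thesis
      by (simp add: Cons gap_subst_Cons cauchy_prod_scale_right) (simp add: gap_conv_def)
  qed simp
qed

lemma gap_conv_add_left: "gap_conv (\<lambda>p. L p + M p) \<phi> as = gap_conv L \<phi> as + gap_conv M \<phi> as"
proof -
  have "gap_subst (\<lambda>p. L p + M p) \<phi> = (\<lambda>p. gap_subst L \<phi> p + gap_subst M \<phi> p)"
    by (rule ext) (rule gap_subst_add)
  then show ?thesis by (simp add: gap_conv_def cauchy_prod_add_right)
qed

lemma gap_conv_scale_left: "gap_conv (\<lambda>p. c * L p) \<phi> as = c * gap_conv L \<phi> as"
proof -
  have "gap_subst (\<lambda>p. c * L p) \<phi> = (\<lambda>p. c * gap_subst L \<phi> p)"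
    by (rule ext) (rule gap_subst_scale)
  then show ?thesis by (simp add: gap_conv_def cauchy_prod_scale_right)
qed

text \<open>Substitution is multiplicative. In the induction the first letter of a word of the product \<open>\<psi> M\<close>
  comes from \<open>M\<close> (if the word from \<open>\<psi>\<close> is empty) or from \<open>\<psi>\<close>; in the second case the gap behind it is
  absorbed by associativity.\<close>

lemma gap_subst_cauchy_prod:
  "gap_subst (cauchy_prod \<psi> M) \<phi> as = cauchy_prod (gap_subst \<psi> \<phi>) (gap_subst M \<phi>) as"
proof (induction "as" arbitrary: \<psi> rule: length_induct)
  case (1 "as")
  show ?case
  proof (cases "as")
    case Nil
    then show ?thesis by (simp add: cauchy_prod_Nil)
  next
    case (Cons a bs)
    let ?\<psi> = "\<lambda>p. \<psi> (a # p)" and ?M = "\<lambda>p. M (a # p)"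
    have IH: "cauchy_prod \<phi> (gap_subst (cauchy_prod ?\<psi> M) \<phi>) bs
        = cauchy_prod \<phi> (cauchy_prod (gap_subst ?\<psi> \<phi>) (gap_subst M \<phi>)) bs"
      using 1 Cons by (intro cauchy_prod_cong) auto
    have "gap_subst (cauchy_prod \<psi> M) \<phi> as = gap_conv (\<lambda>p. \<psi> [] * ?M p + cauchy_prod ?\<psi> M p) \<phi> bs"
      by (simp add: Cons gap_subst_Cons cauchy_prod_Cons)
    also have "\<dots> = \<psi> [] * gap_subst M \<phi> (a # bs) + cauchy_prod \<phi> (gap_subst (cauchy_prod ?\<psi> M) \<phi>) bs"
      unfolding gap_conv_add_left gap_conv_scale_left gap_subst_Cons by (simp add: gap_conv_def)
    also have "cauchy_prod \<phi> (gap_subst (cauchy_prod ?\<psi> M) \<phi>) bs = cauchy_prod (gap_conv ?\<psi> \<phi>) (gap_subst M \<phi>) bs"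
      unfolding IH by (simp add: gap_conv_def cauchy_prod_assoc)
    finally show ?thesis
      by (simp add: Cons cauchy_prod_Cons gap_subst_Cons)
  qed
qed

text \<open>Both sides are substitutions, and by multiplicativity they agree on letters:
  \<open>\<sigma>\<^sub>\<phi>(a \<psi>) = a \<phi> \<sigma>\<^sub>\<phi>(\<psi>)\<close>. This is the heart of the action property.\<close>

lemma gap_subst_gap_subst:
  "gap_subst (gap_subst L \<psi>) \<phi> as = gap_subst L (gap_conv \<psi> \<phi>) as"
proof (induction "as" arbitrary: L rule: length_induct)
  case (1 "as")
  show ?case
  proof (cases "as")
    case (Cons a bs)
    let ?L = "\<lambda>p. L (a # p)"
    have "gap_subst (gap_subst L \<psi>) \<phi> as = cauchy_prod \<phi> (gap_subst (cauchy_prod \<psi> (gap_subst ?L \<psi>)) \<phi>) bs"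
      by (simp add: Cons gap_subst_Cons gap_conv_def)
    also have "\<dots> = cauchy_prod \<phi> (cauchy_prod (gap_subst \<psi> \<phi>) (gap_subst (gap_subst ?L \<psi>) \<phi>)) bs"
      by (rule cauchy_prod_cong) (simp_all add: gap_subst_cauchy_prod)
    also have "\<dots> = cauchy_prod (gap_conv \<psi> \<phi>) (gap_subst (gap_subst ?L \<psi>) \<phi>) bs"
      by (simp add: gap_conv_def cauchy_prod_assoc)
    also have "\<dots> = cauchy_prod (gap_conv \<psi> \<phi>) (gap_subst ?L (gap_conv \<psi> \<phi>)) bs"
      using 1 Cons by (intro cauchy_prod_cong) auto
    also have "\<dots> = gap_subst L (gap_conv \<psi> \<phi>) as"
      by (simp add: Cons gap_subst_Cons) (simp add: gap_conv_def)
    finally show ?thesis .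
  qed simp
qed

text \<open>By multiplicativity and the composition of substitutions,
  \<open>\<phi> \<sigma>\<^sub>\<phi>(\<psi> \<sigma>\<^sub>\<psi>(L)) = \<phi> \<sigma>\<^sub>\<phi>(\<psi>) \<sigma>\<^sub>\<phi>(\<sigma>\<^sub>\<psi>(L))\<close>, and \<open>\<phi> \<sigma>\<^sub>\<phi>(\<psi>)\<close> is the convolution of \<open>\<psi>\<close> and \<open>\<phi>\<close>.\<close>

lemma gap_conv_assoc: "gap_conv (gap_conv L \<psi>) \<phi> = gap_conv L (gap_conv \<psi> \<phi>)"
proof
  fix as
  have "gap_conv (gap_conv L \<psi>) \<phi> as
      = cauchy_prod \<phi> (cauchy_prod (gap_subst \<psi> \<phi>) (gap_subst (gap_subst L \<psi>) \<phi>)) as"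
    unfolding gap_conv_def by (rule cauchy_prod_cong) (simp_all add: gap_subst_cauchy_prod)
  also have "\<dots> = cauchy_prod (cauchy_prod \<phi> (gap_subst \<psi> \<phi>)) (gap_subst L (gap_conv \<psi> \<phi>)) as"
    by (simp add: cauchy_prod_assoc gap_subst_gap_subst cong: cauchy_prod_cong)
  also have "\<dots> = gap_conv L (gap_conv \<psi> \<phi>) as"
    by (simp add: gap_conv_def)
  finally show "gap_conv (gap_conv L \<psi>) \<phi> as = gap_conv L (gap_conv \<psi> \<phi>) as" .
qed

lemma gap_subst_unit_right: "gap_subst L unit_word as = L as"
proof (induction "as" arbitrary: L)
  case (Cons a as)
  then show ?case by (simp add: gap_subst_Cons gap_conv_def cauchy_prod_unit_left)
qed simp

lemma gap_conv_unit_left: "gap_conv unit_word \<phi> = \<phi>"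
proof
  fix as
  have "gap_subst unit_word \<phi> p = unit_word p" for p
  proof (cases p)
    case (Cons a q)
    then show ?thesis
      using gap_subst_scale[of 0 "\<lambda>_. 0" \<phi>]
      by (simp add: gap_subst_Cons gap_conv_def unit_word_def cauchy_prod_def)
  qed simp
  then have "gap_subst unit_word \<phi> = unit_word" by (rule ext)
  then show "gap_conv unit_word \<phi> as = \<phi> as"
    by (simp add: gap_conv_def cauchy_prod_unit_right)
qed

text \<open>If all letters of a word \<open>w\<close> are chosen, every gap is empty, and as \<open>\<phi> [] = 1\<close> the term is \<open>L(w)\<close>;
  every other term evaluates \<open>L\<close> on a shorter word. So \<open>\<sigma>\<^sub>\<phi> - id\<close> only looks at shorter words.\<close>

lemma gap_subst_triangular:
  assumes "\<phi> [] = 1" "\<And>p. length p < length as \<Longrightarrow> L p = M p"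
  shows "gap_subst L \<phi> as - L as = gap_subst M \<phi> as - M as"
  using assms(2)
proof (induction "as" arbitrary: L M rule: length_induct)
  case (1 "as")
  show ?case
  proof (cases "as")
    case (Cons a bs)
    have *: "gap_subst (\<lambda>p. L (a # p)) \<phi> bs - L as = gap_subst (\<lambda>p. M (a # p)) \<phi> bs - M as"
      using 1(1)[rule_format, of bs "\<lambda>p. L (a # p)" "\<lambda>p. M (a # p)"] 1(2) by (simp add: Cons)
    have eq: "gap_subst (\<lambda>p. L (a # p)) \<phi> p = gap_subst (\<lambda>p. M (a # p)) \<phi> p" if "length p < length bs" for p
    proof -
      have "gap_subst (\<lambda>p. L (a # p)) \<phi> p - L (a # p) = gap_subst (\<lambda>p. M (a # p)) \<phi> p - M (a # p)"
        using 1(1)[rule_format, of p "\<lambda>p. L (a # p)" "\<lambda>p. M (a # p)"] 1(2) that by (simp add: Cons)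
      moreover have "L (a # p) = M (a # p)"
        using 1(2) Cons that by auto
      ultimately show ?thesis by simp
    qed
    show ?thesis
    proof (cases bs)
      case Nil
      then show ?thesis using * by (simp add: Cons gap_subst_Cons gap_conv_def cauchy_prod_Nil assms(1))
    next
      case (Cons b cs)
      have "cauchy_prod (\<lambda>p. \<phi> (b # p)) (gap_subst (\<lambda>p. L (a # p)) \<phi>) cs
        = cauchy_prod (\<lambda>p. \<phi> (b # p)) (gap_subst (\<lambda>p. M (a # p)) \<phi>) cs"
        using eq Cons by (intro cauchy_prod_cong) auto
      then show ?thesis
        using * \<open>as = a # bs\<close> Cons by (simp add: gap_subst_Cons[of _ _ a] gap_conv_def cauchy_prod_Cons assms(1))
    qed
  qed simp
qed

lemma gap_conv_triangular:
  assumes "\<phi> [] = 1" "\<And>p. length p < length as \<Longrightarrow> L p = M p"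
  shows "gap_conv L \<phi> as - L as = gap_conv M \<phi> as - M as"
proof (cases "as")
  case Nil
  then show ?thesis by (simp add: gap_conv_def cauchy_prod_Nil assms(1))
next
  case (Cons b cs)
  have "gap_subst L \<phi> p = gap_subst M \<phi> p" if "length p < length as" for p
    using gap_subst_triangular[of \<phi> p L M] assms that by auto
  then have "cauchy_prod (\<lambda>p. \<phi> (b # p)) (gap_subst L \<phi>) cs = cauchy_prod (\<lambda>p. \<phi> (b # p)) (gap_subst M \<phi>) cs"
    using Cons by (intro cauchy_prod_cong) auto
  then show ?thesis
    using gap_subst_triangular[of \<phi> "as" L M] assms by (simp add: gap_conv_def cauchy_prod_Cons Cons)
qed

section \<open>Connected components of sets of positions\<close>

text \<open>Maximality among intervals is a local condition: neither neighbour of the interval may be added. This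
  form is the one that is easy to transport along shifts and restrictions.\<close>

lemma components_iff:
  "J \<in> components X \<longleftrightarrow>
    (\<exists>i j. J = {i..j} \<and> i \<le> j \<and> {i..j} \<subseteq> X \<and> Suc j \<notin> X \<and> (i = 0 \<or> i - 1 \<notin> X))"
proof
  assume J: "J \<in> components X"
  then obtain i j where ij: "J = {i..j}" "i \<le> j" "{i..j} \<subseteq> X"
    by (auto simp: components_def)
  have max: "{i'..j'} = {i..j}" if "{i..j} \<subseteq> {i'..j'}" "{i'..j'} \<subseteq> X" for i' j'
    using J that by (auto simp: components_def ij(1))
  have "Suc j \<notin> X"
  proof
    assume "Suc j \<in> X"
    then have "{i..Suc j} = {i..j}"
      using ij by (intro max) (auto simp: le_Suc_eq)
    moreover have "Suc j \<in> {i..Suc j}" using ij(2) by simp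
    ultimately show False by simp
  qed
  moreover have "i - 1 \<notin> X" if "i \<noteq> 0"
  proof
    assume "i - 1 \<in> X"
    then have "x \<in> X" if "x \<in> {i - 1..j}" for x
      using ij that by (cases "x = i - 1") auto
    then have "{i - 1..j} = {i..j}"
      using ij by (intro max) auto
    moreover have "i - 1 \<in> {i - 1..j}" using ij(2) by simp
    ultimately have "i - 1 \<in> {i..j}" by simp
    then show False using \<open>i \<noteq> 0\<close> by auto
  qed
  moreover from calculation have "i = 0 \<or> i - 1 \<notin> X" by auto
  ultimately show "\<exists>i j. J = {i..j} \<and> i \<le> j \<and> {i..j} \<subseteq> X \<and> Suc j \<notin> X \<and> (i = 0 \<or> i - 1 \<notin> X)"
    using ij by - (rule exI[of _ i], rule exI[of _ j], simp)
next
  assume "\<exists>i j. J = {i..j} \<and> i \<le> j \<and> {i..j} \<subseteq> X \<and> Suc j \<notin> X \<and> (i = 0 \<or> i - 1 \<notin> X)"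
  then obtain i j where ij: "J = {i..j}" "i \<le> j" "{i..j} \<subseteq> X" "Suc j \<notin> X" "i = 0 \<or> i - 1 \<notin> X"
    by blast
  have "{i'..j'} = {i..j}" if *: "{i..j} \<subseteq> {i'..j'}" "{i'..j'} \<subseteq> X" for i' j'
  proof -
    have le: "i' \<le> i" "j \<le> j'" using *(1) ij(2) by auto
    have "j' \<le> j"
    proof (rule ccontr)
      assume "\<not> j' \<le> j"
      then have "Suc j \<in> {i'..j'}" using le ij(2) by auto
      then show False using *(2) ij(4) by auto
    qed
    moreover have "i \<le> i'"
    proof (rule ccontr)
      assume "\<not> i \<le> i'"
      then have "i - 1 \<in> {i'..j'}" "i \<noteq> 0" using le ij(2) by auto
      then show False using *(2) ij(5) by auto
    qed
    ultimately show ?thesis using le by simp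
  qed
  then show "J \<in> components X"
    using ij(2,3) by (auto simp: components_def ij(1))
qed

lemma finite_components: "finite X \<Longrightarrow> finite (components X)"
  by (rule finite_subset[of _ "Pow X"]) (auto simp: components_def)

lemma inj_on_Min_components: "inj_on Min (components X)"
proof (rule inj_onI)
  fix J K assume "J \<in> components X" "K \<in> components X" and eq: "Min J = Min K"
  then obtain i j i' j' where J: "J = {i..j}" "i \<le> j" "{i..j} \<subseteq> X" "Suc j \<notin> X"
    and K: "K = {i'..j'}" "i' \<le> j'" "{i'..j'} \<subseteq> X" "Suc j' \<notin> X"
    unfolding components_iff by blast
  have "Min {i..j} = i" "Min {i'..j'} = i'"
    using J(2) K(2) by (auto intro: Min_eqI)
  then have ii: "i = i'" using eq J K by simp
  have "\<not> j < j'"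
  proof
    assume "j < j'"
    then have "Suc j \<in> {i'..j'}" using ii J(2) by auto
    then show False using K J by blast
  qed
  moreover have "\<not> j' < j"
  proof
    assume "j' < j"
    then have "Suc j' \<in> {i..j}" using ii K(2) by auto
    then show False using K J by blast
  qed
  ultimately show "J = K" using ii J K by simp
qed

lemma sorted_key_list_of_set_inj_on:
  fixes f :: "'b \<Rightarrow> 'c::linorder"
  assumes "finite A" "inj_on f A"
  shows "set (sorted_key_list_of_set f A) = A \<and> distinct (sorted_key_list_of_set f A)"
proof -
  interpret folding_on A "insort_key f" "[]"
  proof
    fix x y assume "x \<in> A" "y \<in> A"
    then show "insort_key f y \<circ> insort_key f x = insort_key f x \<circ> insort_key f y"
      using assms(2) insort_key_left_comm[of f x y] by (cases "x = y") (auto simp: inj_on_def fun_eq_iff)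
  qed
  note F_insert = insert
  have "B \<subseteq> A \<longrightarrow> set (F B) = B \<and> distinct (F B)" if "finite B" for B
    using that
  proof (induction B)
    case (insert x B)
    show ?case
    proof
      assume "insert x B \<subseteq> A"
      moreover from this have "F (insert x B) = insort_key f x (F B)"
        by (intro F_insert) (use insert.hyps in auto)
      ultimately show "set (F (insert x B)) = insert x B \<and> distinct (F (insert x B))"
        using insert.IH insert.hyps by (simp add: set_insort_key distinct_insort)
    qed
  qed simp
  from this[OF assms(1)] show ?thesis
    unfolding sorted_key_list_of_set_def by blast
qed

lemma prod_list_component_list:
  "finite X \<Longrightarrow> prod_list (map f (component_list X)) = (\<Prod>J\<in>components X. f J :: 'k::comm_monoid_mult)"
  using sorted_key_list_of_set_inj_on[OF finite_components inj_on_Min_components, of X]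
    prod.distinct_set_conv_list[of "component_list X" f]
  by (simp add: component_list_def)

lemma set_component_list: "finite X \<Longrightarrow> set (component_list X) = components X"
  using sorted_key_list_of_set_inj_on[OF finite_components inj_on_Min_components, of X]
  by (simp add: component_list_def)

lemma components_shift: "components ((+) m ` Y) = (`) ((+) m) ` components Y"
proof (intro Set.set_eqI iffI)
  fix J assume "J \<in> components ((+) m ` Y)"
  then obtain i j where J: "J = {i..j}" "i \<le> j" "{i..j} \<subseteq> (+) m ` Y" "Suc j \<notin> (+) m ` Y"
      "i = 0 \<or> i - 1 \<notin> (+) m ` Y"
    unfolding components_iff by blast
  have "i \<in> (+) m ` Y" using J by auto
  then have "m \<le> i" by auto
  then obtain i' j' where ij: "i = m + i'" "j = m + j'"
    using J(2) by (metis le_iff_add le_trans)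
  have "{i'..j'} \<in> components Y"
    unfolding components_iff
  proof (intro exI conjI)
    show "{i'..j'} = {i'..j'}" "i' \<le> j'" using J ij by auto
    show "{i'..j'} \<subseteq> Y"
    proof
      fix x assume "x \<in> {i'..j'}"
      then have "m + x \<in> (+) m ` Y" using J(3) ij by auto
      then show "x \<in> Y" by auto
    qed
    show "Suc j' \<notin> Y" using J(4) ij by (metis add_Suc_right imageI)
    show "i' = 0 \<or> i' - 1 \<notin> Y"
    proof (cases i')
      case (Suc i'')
      have "m + i'' \<notin> (+) m ` Y" using J(5) ij Suc by simp
      then show ?thesis using Suc by auto
    qed simp
  qed
  then show "J \<in> (`) ((+) m) ` components Y"
    using J(1) ij by (intro image_eqI[of _ _ "{i'..j'}"]) simp_all
next
  fix J assume "J \<in> (`) ((+) m) ` components Y"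
  then obtain i j where J: "J = (+) m ` {i..j}" "i \<le> j" "{i..j} \<subseteq> Y" "Suc j \<notin> Y" "i = 0 \<or> i - 1 \<notin> Y"
    by (auto simp: components_iff)
  show "J \<in> components ((+) m ` Y)"
    unfolding components_iff
  proof (intro exI conjI)
    show "J = {m + i..m + j}" using J(1) by simp
    show "m + i \<le> m + j" using J by simp
    show "{m + i..m + j} \<subseteq> (+) m ` Y" using image_mono[OF J(3), of "(+) m"] by (simp add: add.commute)
    show "Suc (m + j) \<notin> (+) m ` Y" using J(4) by (metis add_Suc_right add_left_cancel imageE)
    show "m + i = 0 \<or> m + i - 1 \<notin> (+) m ` Y"
    proof (cases i)
      case 0
      then show ?thesis by (cases m) auto
    next
      case (Suc i')
      then show ?thesis using J(5) by auto
    qed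
  qed
qed

lemma components_split:
  assumes "m \<notin> X"
  shows "components X = components (X \<inter> {..<m}) \<union> components (X \<inter> {m<..})"
proof -
  have side: "{i..j} \<subseteq> {..<m} \<or> {i..j} \<subseteq> {m<..}" if "{i..j} \<subseteq> X" for i j
  proof -
    have "m \<notin> {i..j}" using assms that by blast
    then show ?thesis by auto
  qed
  show ?thesis
  proof (intro Set.set_eqI iffI)
    fix J assume "J \<in> components X"
    then obtain i j where J: "J = {i..j}" "i \<le> j" "{i..j} \<subseteq> X" "Suc j \<notin> X" "i = 0 \<or> i - 1 \<notin> X"
      unfolding components_iff by blast
    from side[OF J(3)] show "J \<in> components (X \<inter> {..<m}) \<union> components (X \<inter> {m<..})"
    proof
      assume "{i..j} \<subseteq> {..<m}"
      then have "J \<in> components (X \<inter> {..<m})"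
        unfolding components_iff using J by - (rule exI[of _ i], rule exI[of _ j], auto)
      then show ?thesis ..
    next
      assume "{i..j} \<subseteq> {m<..}"
      then have "J \<in> components (X \<inter> {m<..})"
        unfolding components_iff using J by - (rule exI[of _ i], rule exI[of _ j], auto)
      then show ?thesis ..
    qed
  next
    fix J assume "J \<in> components (X \<inter> {..<m}) \<union> components (X \<inter> {m<..})"
    then show "J \<in> components X"
    proof
      assume "J \<in> components (X \<inter> {..<m})"
      then obtain i j where J: "J = {i..j}" "i \<le> j" "{i..j} \<subseteq> X \<inter> {..<m}" "Suc j \<notin> X \<inter> {..<m}"
          "i = 0 \<or> i - 1 \<notin> X \<inter> {..<m}"
        unfolding components_iff by blast
      have "i < m" "j < m" using J(2,3) by auto
      moreover have "Suc j \<notin> X" using J(4) assms \<open>j < m\<close> by (cases "Suc j = m") auto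
      ultimately show ?thesis
        unfolding components_iff using J by - (rule exI[of _ i], rule exI[of _ j], auto)
    next
      assume "J \<in> components (X \<inter> {m<..})"
      then obtain i j where J: "J = {i..j}" "i \<le> j" "{i..j} \<subseteq> X \<inter> {m<..}" "Suc j \<notin> X \<inter> {m<..}"
          "i = 0 \<or> i - 1 \<notin> X \<inter> {m<..}"
        unfolding components_iff by blast
      have "m < i" "m < j" using J(2,3) by auto
      moreover have "i - 1 \<notin> X" using J(5) assms \<open>m < i\<close> by (cases "i - 1 = m") auto
      ultimately show ?thesis
        unfolding components_iff using J by - (rule exI[of _ i], rule exI[of _ j], auto)
    qed
  qed
qed

lemma components_lessThan: "components {..<n} = (if n = 0 then {} else {{..<n}})"
proof (cases n)
  case 0
  then show ?thesis by (auto simp: components_def)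
next
  case (Suc m)
  have "J \<in> components {..<n} \<longleftrightarrow> J = {0..m}" for J
  proof
    assume "J \<in> components {..<n}"
    then obtain i j where J: "J = {i..j}" "i \<le> j" "{i..j} \<subseteq> {..<n}" "Suc j \<notin> {..<n}"
          "i = 0 \<or> i - 1 \<notin> {..<n}"
        unfolding components_iff by blast
    then have "j < n" "i < n" by auto
    then have "j = m" "i = 0" using J(4,5) Suc by auto
    then show "J = {0..m}" using J by simp
  qed (auto simp: components_iff Suc intro!: exI[of _ 0] exI[of _ m])
  then show ?thesis using Suc by (auto simp: atLeast0AtMost lessThan_Suc_atMost)
qed

section \<open>Subsets of positions as factorizations\<close>

definition gap_prod :: "('a list \<Rightarrow> 'k) \<Rightarrow> 'a list \<Rightarrow> nat set \<Rightarrow> 'k::comm_ring_1"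
  where "gap_prod \<phi> as X = (\<Prod>J\<in>components X. \<phi> (nths as J))"

lemma gap_prod_shift: "gap_prod \<phi> as ((+) m ` Y) = gap_prod \<phi> (drop m as) Y"
proof -
  have "inj_on ((`) ((+) m)) (components Y)"
    by (rule inj_onI) (metis inj_image_eq_iff inj_on_add)
  then show ?thesis
    by (simp add: gap_prod_def components_shift prod.reindex nths_drop)
qed

text \<open>For \<open>n = 0\<close> there is no component, and the left-hand side is an empty product; this is why
  \<open>\<phi> [] = 1\<close> is assumed.\<close>

lemma gap_prod_lessThan: "\<phi> [] = 1 \<Longrightarrow> gap_prod \<phi> as {..<n} = \<phi> (take n as)"
  by (simp add: gap_prod_def components_lessThan)

lemma gap_prod_split:
  assumes "m \<notin> X" "finite X"
  shows "gap_prod \<phi> as X = gap_prod \<phi> as (X \<inter> {..<m}) * gap_prod \<phi> as (X \<inter> {m<..})"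
proof -
  have "J = {}" if "J \<subseteq> {..<m}" "J \<subseteq> {m<..}" for J
    using that by fastforce
  then have "components (X \<inter> {..<m}) \<inter> components (X \<inter> {m<..}) = {}"
    by (auto simp: components_def)
  then show ?thesis
    unfolding gap_prod_def components_split[OF assms(1)]
    by (rule prod.union_disjoint[rotated 2]) (use assms(2) in \<open>auto intro: finite_components\<close>)
qed

text \<open>Cutting off the chosen first letter shifts the remaining choice and the components of its complement
  by one position.\<close>

lemma sum_subsets_with_first_letter:
  fixes L :: "'a list \<Rightarrow> 'k::comm_ring_1"
  shows "(\<Sum>S\<in>{S \<in> Pow {..<length (a # as)}. 0 \<in> S}.
      L (nths (a # as) S) * gap_prod \<phi> (a # as) ({..<length (a # as)} - S)) =
    (\<Sum>S\<in>Pow {..<length as}. L (a # nths as S) * gap_prod \<phi> as ({..<length as} - S))"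
proof (rule sum.reindex_bij_witness[where i = "\<lambda>S. insert 0 (Suc ` S)" and j = "\<lambda>S. {i. Suc i \<in> S}"])
  fix S assume S: "S \<in> {S \<in> Pow {..<length (a # as)}. 0 \<in> S}"
  show eq: "insert 0 (Suc ` {i. Suc i \<in> S}) = S"
  proof (intro Set.set_eqI)
    fix x show "x \<in> insert 0 (Suc ` {i. Suc i \<in> S}) \<longleftrightarrow> x \<in> S"
      using S by (cases x) auto
  qed
  show "{i. Suc i \<in> S} \<in> Pow {..<length as}" using S by auto
  have "{..<length (a # as)} - S = (+) 1 ` ({..<length as} - {i. Suc i \<in> S})"
  proof (intro Set.set_eqI)
    fix x show "x \<in> {..<length (a # as)} - S \<longleftrightarrow> x \<in> (+) 1 ` ({..<length as} - {i. Suc i \<in> S})"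
      using S by (cases x) auto
  qed
  then show "L (a # nths as {i. Suc i \<in> S}) * gap_prod \<phi> as ({..<length as} - {i. Suc i \<in> S}) =
      L (nths (a # as) S) * gap_prod \<phi> (a # as) ({..<length (a # as)} - S)"
    using S by (simp only: gap_prod_shift) (simp add: nths_Cons)
qed auto

text \<open>If \<open>k\<close> is the first chosen position, the first \<open>k\<close> letters form one gap, and the rest of the choice
  is one for \<open>drop k as\<close> that contains its first position.\<close>

lemma sum_subsets_with_min:
  fixes L :: "'a list \<Rightarrow> 'k::comm_ring_1"
  assumes "\<phi> [] = 1" "k < length as"
  shows "(\<Sum>S\<in>{S \<in> Pow {..<length as} - {{}}. Min S = k}.
      L (nths as S) * gap_prod \<phi> as ({..<length as} - S)) =
    \<phi> (take k as) * (\<Sum>S\<in>{S \<in> Pow {..<length (drop k as)}. 0 \<in> S}.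
      L (nths (drop k as) S) * gap_prod \<phi> (drop k as) ({..<length (drop k as)} - S))"
  unfolding sum_distrib_left
proof (rule sum.reindex_bij_witness[where i = "\<lambda>S. (+) k ` S" and j = "\<lambda>S. {i. k + i \<in> S}"])
  fix S assume S: "S \<in> {S \<in> Pow {..<length as} - {{}}. Min S = k}"
  then have fin: "finite S" by (auto intro: finite_subset)
  have k: "k \<in> S" using S fin Min_in[of S] by auto
  have ge: "k \<le> x" if "x \<in> S" for x using S fin that by auto
  show eq: "(+) k ` {i. k + i \<in> S} = S"
  proof (intro Set.set_eqI iffI)
    fix x assume "x \<in> S"
    then show "x \<in> (+) k ` {i. k + i \<in> S}"
      using ge[of x] by (intro image_eqI[of _ _ "x - k"]) auto
  qed auto
  show "{i. k + i \<in> S} \<in> {S \<in> Pow {..<length (drop k as)}. 0 \<in> S}"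
    using S k by auto
  let ?X = "{..<length as} - S"
  have low: "?X \<inter> {..<k} = {..<k}"
    using ge assms(2) by force
  have high: "?X \<inter> {k<..} = (+) k ` ({..<length (drop k as)} - {i. k + i \<in> S})"
  proof (intro Set.set_eqI iffI)
    fix x assume "x \<in> ?X \<inter> {k<..}"
    then show "x \<in> (+) k ` ({..<length (drop k as)} - {i. k + i \<in> S})"
      by (intro image_eqI[of _ _ "x - k"]) auto
  next
    fix x assume "x \<in> (+) k ` ({..<length (drop k as)} - {i. k + i \<in> S})"
    then obtain i where i: "x = k + i" "i < length as - k" "k + i \<notin> S" by auto
    then have "i \<noteq> 0" using k by (cases i) auto
    then show "x \<in> ?X \<inter> {k<..}" using i by auto
  qed
  have "gap_prod \<phi> as ?X = \<phi> (take k as) *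
      gap_prod \<phi> (drop k as) ({..<length (drop k as)} - {i. k + i \<in> S})"
    using gap_prod_split[of k ?X \<phi> "as"] k
    by (simp only: low high gap_prod_lessThan[of \<phi>, OF assms(1)] gap_prod_shift) simp
  moreover have "nths as S = nths (drop k as) {i. k + i \<in> S}"
    by (simp only: nths_drop eq)
  ultimately show "\<phi> (take k as) * (L (nths (drop k as) {i. k + i \<in> S}) *
      gap_prod \<phi> (drop k as) ({..<length (drop k as)} - {i. k + i \<in> S})) =
      L (nths as S) * gap_prod \<phi> as ?X"
    by (simp add: ac_simps)
next
  fix S assume S: "S \<in> {S \<in> Pow {..<length (drop k as)}. 0 \<in> S}"
  then have fin: "finite S" by (auto intro: finite_subset)
  show "{i. k + i \<in> (+) k ` S} = S" by auto
  have "Min ((+) k ` S) = k"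
    using S fin by (intro Min_eqI) (auto intro: image_eqI[of _ _ 0])
  then show "(+) k ` S \<in> {S \<in> Pow {..<length as} - {{}}. Min S = k}"
    using S assms(2) by auto
qed

text \<open>Subsets are sorted by their minimum \<open>k\<close>, the length of the gap in front. The empty subset has no
  minimum; it gives the term in which this gap is the whole word.\<close>

lemma gap_conv_eq_sum_subsets:
  fixes L :: "'a list \<Rightarrow> 'k::comm_ring_1"
  assumes "\<phi> [] = 1"
  shows "(\<Sum>S\<in>Pow {..<length as}. L (nths as S) * gap_prod \<phi> as ({..<length as} - S)) = gap_conv L \<phi> as"
proof (induction "as" arbitrary: L rule: length_induct)
  case (1 "as")
  let ?F = "\<lambda>S. L (nths as S) * gap_prod \<phi> as ({..<length as} - S)"
  have min_term: "sum ?F {S \<in> Pow {..<length as} - {{}}. Min S = k} =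
      \<phi> (take k as) * gap_subst L \<phi> (drop k as)" if k: "k < length as" for k
  proof -
    obtain b bs where b: "drop k as = b # bs"
      using k by (cases "drop k as") auto
    have "length bs < length as"
      using arg_cong[OF b, of length] k by simp
    from 1[rule_format, OF this, of "\<lambda>p. L (b # p)"]
    have "(\<Sum>S\<in>Pow {..<length bs}. L (b # nths bs S) * gap_prod \<phi> bs ({..<length bs} - S)) =
        gap_conv (\<lambda>p. L (b # p)) \<phi> bs" .
    then show ?thesis
      unfolding sum_subsets_with_min[of \<phi>, OF assms k] b sum_subsets_with_first_letter gap_subst_Cons by simp
  qed
  have "sum ?F (Pow {..<length as}) = ?F {} + sum ?F (Pow {..<length as} - {{}})"
    by (rule sum.remove) auto
  also have "sum ?F (Pow {..<length as} - {{}}) =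
      (\<Sum>k<length as. sum ?F {S \<in> Pow {..<length as} - {{}}. Min S = k})"
  proof (rule sum.group[symmetric])
    show "Min ` (Pow {..<length as} - {{}}) \<subseteq> {..<length as}"
      using Min_in finite_subset[OF _ finite_lessThan] by blast
  qed auto
  also have "\<dots> = (\<Sum>k<length as. \<phi> (take k as) * gap_subst L \<phi> (drop k as))"
    by (rule sum.cong[OF refl], rule min_term) simp
  also have "?F {} = \<phi> as * L []"
    by (simp add: gap_prod_lessThan assms)
  finally show ?case
    by (simp add: gap_conv_def cauchy_prod_def lessThan_Suc_atMost[symmetric])
qed

lemma gap_subst_eq_sum_subsets:
  fixes L :: "'a list \<Rightarrow> 'k::comm_ring_1"
  assumes "\<phi> [] = 1" "as \<noteq> []"
  shows "(\<Sum>S\<in>{S \<in> Pow {..<length as}. 0 \<in> S}.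
      L (nths as S) * gap_prod \<phi> as ({..<length as} - S)) = gap_subst L \<phi> as"
proof -
  obtain b bs where b: "as = b # bs" using assms(2) by (cases "as") auto
  show ?thesis
    unfolding b sum_subsets_with_first_letter gap_subst_Cons
    by (rule gap_conv_eq_sum_subsets[of \<phi> "\<lambda>p. L (b # p)"], rule assms(1))
qed

section \<open>Multilinearity and inverses\<close>

abbreviation multilinear_forms :: "('k::field \<Rightarrow> 'v::ab_group_add \<Rightarrow> 'v) \<Rightarrow> 'v set \<Rightarrow> ('v list \<Rightarrow> 'k) set"
  where "multilinear_forms s V \<equiv> multilinear_maps s V (*)"

lemma multilinear_forms_Cons:
  assumes "f \<in> multilinear_forms s V" "a \<in> V"
  shows "(\<lambda>p. f (a # p)) \<in> multilinear_forms s V"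
proof (rule multilinear_mapsI)
  fix xs ys u v c assume "xs \<in> lists V" "ys \<in> lists V" "u \<in> V"
  then have *: "a # xs \<in> lists V" "ys \<in> lists V" "u \<in> V" using assms by auto
  note D = multilinear_mapsD[OF assms(1) *]
  show "f (a # xs @ s c u # ys) = c * f (a # xs @ u # ys)" using D(2) by simp
  show "f (a # xs @ (u + v) # ys) = f (a # xs @ u # ys) + f (a # xs @ v # ys)" if "v \<in> V"
    using D(1)[OF that] by simp
qed

lemma multilinear_forms_lincomb:
  assumes "f \<in> multilinear_forms s V" "g \<in> multilinear_forms s V"
  shows "(\<lambda>p. c * f p + g p) \<in> multilinear_forms s V"
  by (rule multilinear_mapsI)
    (simp_all add: multilinear_mapsD[OF assms(1)] multilinear_mapsD[OF assms(2)] algebra_simps)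

lemma multilinear_forms_scale:
  assumes "f \<in> multilinear_forms s V"
  shows "(\<lambda>p. c * f p) \<in> multilinear_forms s V"
  by (rule multilinear_mapsI) (simp_all add: multilinear_mapsD[OF assms] algebra_simps)

lemma cauchy_prod_multilinear:
  assumes f: "f \<in> multilinear_forms s UNIV" and g: "g \<in> multilinear_forms s UNIV"
  shows "cauchy_prod f g \<in> multilinear_forms s UNIV"
proof (rule multilinear_mapsI)
  note D = multilinear_mapsD[of _ s UNIV "(*)"]
  fix xs ys :: "'a list" and u v c
  show "cauchy_prod f g (xs @ s c u # ys) = c * cauchy_prod f g (xs @ u # ys)"
    using f
  proof (induction xs arbitrary: f)
    case Nil
    then show ?case
      using D(2)[OF Nil, of "[]" _ u c] D(2)[OF g, of "[]" ys u c]
      by (simp add: cauchy_prod_Cons cauchy_prod_scale_left algebra_simps)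
  next
    case (Cons x xs)
    then show ?case
      using Cons.IH[OF multilinear_forms_Cons[OF Cons.prems, of x]] D(2)[OF g, of "x # xs" ys u c]
      by (simp add: cauchy_prod_Cons algebra_simps)
  qed
  show "cauchy_prod f g (xs @ (u + v) # ys) = cauchy_prod f g (xs @ u # ys) + cauchy_prod f g (xs @ v # ys)"
    using f
  proof (induction xs arbitrary: f)
    case Nil
    then show ?case
      using D(1)[OF Nil, of "[]" _ u v] D(1)[OF g, of "[]" ys u v]
      by (simp add: cauchy_prod_Cons cauchy_prod_add_left algebra_simps)
  next
    case (Cons x xs)
    then show ?case
      using Cons.IH[OF multilinear_forms_Cons[OF Cons.prems, of x]] D(1)[OF g, of "x # xs" ys u v]
      by (simp add: cauchy_prod_Cons algebra_simps)
  qed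
qed

text \<open>Multilinearity of a product needs multilinearity of its factors on all words, whereas an induction on
  length gives it for short words only. Therefore the induction is on the truncations \<open>T n L\<close> of the
  substituted series, which are multilinear because the conditions relate words of equal length.\<close>

lemma gap_subst_multilinear:
  fixes L \<phi> :: "'a::ab_group_add list \<Rightarrow> 'k::field"
  assumes L: "L \<in> multilinear_forms s UNIV" and \<phi>: "\<phi> \<in> multilinear_forms s UNIV"
  shows "gap_subst L \<phi> \<in> multilinear_forms s UNIV"
proof -
  define T where "T n L as = (if length as \<le> n then gap_subst L \<phi> as else 0)" for n L and as :: "'a list"
  note D = multilinear_mapsD[of _ s UNIV "(*)"]
  have T: "T n L \<in> multilinear_forms s UNIV" if "L \<in> multilinear_forms s UNIV" for n L
    using that
  proof (induction n arbitrary: L)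
    case 0
    show ?case by (rule multilinear_mapsI) (simp_all add: T_def)
  next
    case (Suc n)
    have tail: "cauchy_prod \<phi> (T n (\<lambda>p. L (x # p))) \<in> multilinear_forms s UNIV" for x
      by (intro cauchy_prod_multilinear \<phi> Suc.IH multilinear_forms_Cons[OF Suc.prems]) simp
    have T_Cons: "T (Suc n) L (x # xs) = (if length xs \<le> n then cauchy_prod \<phi> (T n (\<lambda>p. L (x # p))) xs else 0)"
      for x xs
    proof -
      have "gap_subst L \<phi> (x # xs) = cauchy_prod \<phi> (T n (\<lambda>p. L (x # p))) xs" if "length xs \<le> n"
        unfolding gap_subst_Cons gap_conv_def using that by (intro cauchy_prod_cong) (auto simp: T_def)
      then show ?thesis by (simp add: T_def)
    qed
    have Nil_case: "T (Suc n) L (x # xs) = (if length xs \<le> n then gap_conv (\<lambda>p. L (x # p)) \<phi> xs else 0)"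
      for x xs by (simp add: T_def gap_subst_Cons)
    show ?case
    proof (rule multilinear_mapsI)
      fix xs ys :: "'a list" and u v c
      show "T (Suc n) L (xs @ s c u # ys) = c * T (Suc n) L (xs @ u # ys)"
      proof (cases xs)
        case Nil
        have "(\<lambda>p. L (s c u # p)) = (\<lambda>p. c * L (u # p))"
          using D(2)[OF Suc.prems, of "[]" _ u c] by simp
        then show ?thesis
          using gap_conv_scale_left[of c "\<lambda>p. L (u # p)" \<phi> ys] unfolding Nil by (simp add: Nil_case)
      next
        case (Cons x xs')
        then show ?thesis using D(2)[OF tail[of x], of xs' ys u c] by (simp add: T_Cons)
      qed
      show "T (Suc n) L (xs @ (u + v) # ys) = T (Suc n) L (xs @ u # ys) + T (Suc n) L (xs @ v # ys)"
      proof (cases xs)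
        case Nil
        have "(\<lambda>p. L ((u + v) # p)) = (\<lambda>p. L (u # p) + L (v # p))"
          using D(1)[OF Suc.prems, of "[]" _ u v] by simp
        then show ?thesis
          using gap_conv_add_left[of "\<lambda>p. L (u # p)" "\<lambda>p. L (v # p)" \<phi> ys]
          unfolding Nil by (simp add: Nil_case)
      next
        case (Cons x xs')
        then show ?thesis using D(1)[OF tail[of x], of xs' ys u v] by (simp add: T_Cons)
      qed
    qed
  qed
  show ?thesis
  proof (rule multilinear_mapsI)
    fix xs ys :: "'a list" and u v c
    let ?n = "Suc (length xs + length ys)"
    show "gap_subst L \<phi> (xs @ s c u # ys) = c * gap_subst L \<phi> (xs @ u # ys)"
      using D(2)[OF T[OF L, of ?n], of xs ys u c] by (simp add: T_def)
    show "gap_subst L \<phi> (xs @ (u + v) # ys) = gap_subst L \<phi> (xs @ u # ys) + gap_subst L \<phi> (xs @ v # ys)"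
      using D(1)[OF T[OF L, of ?n], of xs ys u v] by (simp add: T_def)
  qed
qed

lemma gap_conv_multilinear:
  "L \<in> multilinear_forms s UNIV \<Longrightarrow> \<phi> \<in> multilinear_forms s UNIV \<Longrightarrow> gap_conv L \<phi> \<in> multilinear_forms s UNIV"
  unfolding gap_conv_def by (intro cauchy_prod_multilinear gap_subst_multilinear)

lemma unit_word_multilinear: "unit_word \<in> multilinear_forms s UNIV"
  by (rule multilinear_mapsI) (simp_all add: unit_word_def)

text \<open>The map \<open>\<chi> \<mapsto> gap_conv \<chi> \<psi>\<close> is the identity plus a map \<open>N\<close> that only looks at shorter words, so the
  iteration \<open>\<chi> \<mapsto> unit_word - N \<chi>\<close> stabilizes on each word, and its limit is the solution. Each iterate is
  multilinear, and so is the limit, as the iterate that is used depends only on the length of the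
  word.\<close>

lemma gap_conv_left_inverse:
  fixes \<psi> :: "'a::ab_group_add list \<Rightarrow> 'k::field"
  assumes \<psi>: "\<psi> \<in> multilinear_forms s UNIV" "\<psi> [] = 1"
  obtains \<chi> where "\<chi> \<in> multilinear_forms s UNIV" "\<chi> [] = 1" "gap_conv \<chi> \<psi> = unit_word"
proof -
  define X where "X = rec_nat unit_word (\<lambda>_ f as. unit_word as - (gap_conv f \<psi> as - f as))"
  have X_0: "X 0 = unit_word" and X_Suc: "\<And>n as. X (Suc n) as = unit_word as - (gap_conv (X n) \<psi> as - X n as)"
    by (simp_all add: X_def)
  have lin: "X n \<in> multilinear_forms s UNIV" for n
  proof (induction n)
    case (Suc n)
    have "X (Suc n) = (\<lambda>p. 1 * X n p + ((-1) * gap_conv (X n) \<psi> p + unit_word p))"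
      by (rule ext) (simp add: X_Suc)
    then show ?case
      using Suc by (simp only:)
        (intro multilinear_forms_lincomb gap_conv_multilinear unit_word_multilinear \<psi>)
  qed (simp add: X_0 unit_word_multilinear)
  have step: "X (Suc n) as = X n as" if "length as < n" for n as
    using that
  proof (induction n arbitrary: "as")
    case (Suc n)
    have "gap_conv (X (Suc n)) \<psi> as - X (Suc n) as = gap_conv (X n) \<psi> as - X n as"
      using Suc by (intro gap_conv_triangular \<psi>) auto
    then show ?case by (simp add: X_Suc[of "Suc n"] X_Suc[of n])
  qed simp
  have stable: "X n as = X (Suc (length as)) as" if "Suc (length as) \<le> n" for n as
    using that by (induction n rule: dec_induct) (simp_all add: step)
  define \<chi> where "\<chi> as = X (Suc (length as)) as" for as
  show ?thesis
  proof (rule that[of \<chi>])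
    show "\<chi> \<in> multilinear_forms s UNIV"
    proof (rule multilinear_mapsI)
      fix xs ys :: "'a list" and u v c
      show "\<chi> (xs @ s c u # ys) = c * \<chi> (xs @ u # ys)"
        using multilinear_mapsD(2)[OF lin[of "Suc (length xs + Suc (length ys))"], of xs ys u] by (simp add: \<chi>_def)
      show "\<chi> (xs @ (u + v) # ys) = \<chi> (xs @ u # ys) + \<chi> (xs @ v # ys)"
        using multilinear_mapsD(1)[OF lin[of "Suc (length xs + Suc (length ys))"], of xs ys u v] by (simp add: \<chi>_def)
    qed
    show "\<chi> [] = 1"
      unfolding \<chi>_def list.size X_Suc X_0 gap_conv_unit_left by (simp add: \<psi>(2) unit_word_def)
    show "gap_conv \<chi> \<psi> = unit_word"
    proof
      fix as :: "'a list"
      let ?n = "Suc (length as)"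
      have "gap_conv \<chi> \<psi> as - \<chi> as = gap_conv (X ?n) \<psi> as - X ?n as"
      proof (rule gap_conv_triangular[of \<psi>, OF \<psi>(2)])
        fix p :: "'a list" assume "length p < length as"
        then show "\<chi> p = X ?n p"
          unfolding \<chi>_def by (intro stable[symmetric]) simp
      qed
      then show "gap_conv \<chi> \<psi> as = unit_word as"
        using X_Suc[of ?n "as"] step[of "as" ?n] by (simp add: \<chi>_def)
    qed
  qed
qed

section \<open>Evaluating tensors on forms\<close>

interpretation fspace: vector_space fscale
  by (rule vector_space_fscale)

lemma fscale_apply: "fscale c f x = c * f x"
  by (simp add: fscale_def)

lemma sum_fun_apply: "(\<Sum>i\<in>I. f i) x = (\<Sum>i\<in>I. f i x)"
  by (induction I rule: infinite_finite_induct) simp_all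

lemma linear_maps_eqI:
  assumes t: "vector_space t"
    and f: "f \<in> linear_maps fscale (module.span fscale B) t W"
    and g: "g \<in> linear_maps fscale (module.span fscale B) t W"
    and eq: "\<And>b. b \<in> B \<Longrightarrow> f b = g b"
  shows "f = g"
proof
  interpret t: vector_space t by (rule t)
  fix x
  have zero: "h 0 = 0" if "h \<in> linear_maps fscale (fspace.span B) t W" for h
    using linear_mapsD(3)[OF that fspace.span_zero, of 0] by simp
  show "f x = g x"
  proof (cases "x \<in> fspace.span B")
    case True
    then have "x \<in> fspace.span B \<and> f x = g x"
    proof (induction rule: fspace.span_induct_alt)
      case base
      show "0 \<in> fspace.span B \<and> f 0 = g 0" using fspace.span_zero[of B] zero[OF f] zero[OF g] by (simp only: simp_thms)
    next
      case (step c x y)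
      then have "x \<in> fspace.span B" "fscale c x \<in> fspace.span B"
        by (auto intro: fspace.span_base fspace.span_scale)
      then show "fscale c x + y \<in> fspace.span B \<and> f (fscale c x + y) = g (fscale c x + y)"
        using step linear_mapsD(2,3)[OF f] linear_mapsD(2,3)[OF g] eq
        by (simp add: fspace.span_add)
    qed
    then show ?thesis ..
  next
    case False
    then show ?thesis using linear_mapsD(4)[OF f] linear_mapsD(4)[OF g] by simp
  qed
qed

lemma tensor_apply: "\<phi> \<in> multilinear_forms s V \<Longrightarrow> tensor s V xs \<phi> = \<phi> xs"
  by (simp add: tensor_def pure_def)

lemma tensor_apply_multilinear: "(\<lambda>xs. tensor s V xs \<phi>) \<in> multilinear_forms s V"
  by (rule multilinear_mapsI)
    (simp_all add: multilinear_mapsD[OF tensor_multilinear] fscale_def)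

lemma multilinear_forms_cong:
  assumes V: "\<And>u v. u \<in> V \<Longrightarrow> v \<in> V \<Longrightarrow> u + v \<in> V" "\<And>c u. u \<in> V \<Longrightarrow> s c u \<in> V"
    and eq: "\<And>xs. xs \<in> lists V \<Longrightarrow> f xs = g xs" and f: "f \<in> multilinear_forms s V"
  shows "g \<in> multilinear_forms s V"
proof (rule multilinear_mapsI)
  fix xs ys u v c assume *: "xs \<in> lists V" "ys \<in> lists V" "u \<in> V"
  note D = multilinear_mapsD[OF f *]
  show "g (xs @ s c u # ys) = c * g (xs @ u # ys)"
    using D(2)[of c] * V by (simp flip: eq)
  show "g (xs @ (u + v) # ys) = g (xs @ u # ys) + g (xs @ v # ys)" if "v \<in> V"
    using D(1)[OF that] * V that by (simp flip: eq)
qed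

text \<open>A tensor over \<open>V\<close> sees only the values of a form on lists over \<open>V\<close>. This also holds for forms
  that are not multilinear, on which all tensors vanish.\<close>

lemma tensor_alg_apply_cong:
  assumes V: "\<And>u v. u \<in> V \<Longrightarrow> v \<in> V \<Longrightarrow> u + v \<in> V" "\<And>c u. u \<in> V \<Longrightarrow> s c u \<in> V"
    and eq: "\<And>xs. xs \<in> lists V \<Longrightarrow> f xs = g xs" and t: "t \<in> tensor_alg s V"
  shows "t f = t g"
  using t unfolding tensor_alg_def
proof (induction rule: fspace.span_induct_alt)
  case (step c x y)
  then obtain xs where xs: "xs \<in> lists V" "x = tensor s V xs" by auto
  have "f \<in> multilinear_forms s V \<longleftrightarrow> g \<in> multilinear_forms s V"
    using multilinear_forms_cong[of V s f g] multilinear_forms_cong[of V s g f] V eq by metis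
  then show ?case
    using step xs eq by (simp add: fscale_def tensor_def pure_def)
qed simp

lemma tensor_span_apply_scale:
  assumes \<phi>: "\<phi> \<in> multilinear_forms s V" and t: "t \<in> module.span fscale (tensor s V ` P)"
  shows "t (\<lambda>xs. c * \<phi> xs) = c * t \<phi>"
proof -
  have c\<phi>: "(\<lambda>xs. c * \<phi> xs) \<in> multilinear_forms s V"
    by (rule multilinear_forms_scale[OF \<phi>])
  show ?thesis
    using t
  proof (induction rule: fspace.span_induct_alt)
    case (step d x y)
    then show ?case by (auto simp: fscale_def tensor_apply \<phi> c\<phi> algebra_simps)
  qed simp
qed

text \<open>The concatenation is defined by lifting first in the left and then in the right factor. Removing the
  outer lift at a pure tensor requires that the inner one be multilinear in \<open>xs\<close>, which is checked
  by induction over \<open>y\<close>.\<close>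

lemma tensor_concat_tensor_left:
  fixes s :: "'k::field \<Rightarrow> 'v::ab_group_add \<Rightarrow> 'v"
  assumes V: "\<And>u v. u \<in> V \<Longrightarrow> v \<in> V \<Longrightarrow> u + v \<in> V" "\<And>c u. u \<in> V \<Longrightarrow> s c u \<in> V"
    and xs: "xs \<in> lists V" and y: "y \<in> tensor_alg s V"
  shows "tensor_concat s V (tensor s V xs) y = lift (\<lambda>ys. tensor s V (xs @ ys)) y"
    "lift (\<lambda>ys. tensor s V (xs @ ys)) y \<in> tensor_alg s V"
proof -
  have right: "(\<lambda>zs. tensor s V (us @ zs) \<phi>) \<in> multilinear_forms s V" if "us \<in> lists V" for us \<phi>
  proof (rule multilinear_mapsI)
    fix as bs u v c assume *: "as \<in> lists V" "bs \<in> lists V" "u \<in> V"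
    then have "us @ as \<in> lists V" using that by simp
    note D = multilinear_mapsD[OF tensor_apply_multilinear[of s V \<phi>] this *(2,3)]
    show "tensor s V (us @ as @ s c u # bs) \<phi> = c * tensor s V (us @ as @ u # bs) \<phi>"
      using D(2) by simp
    show "tensor s V (us @ as @ (u + v) # bs) \<phi> = tensor s V (us @ as @ u # bs) \<phi> + tensor s V (us @ as @ v # bs) \<phi>"
      if "v \<in> V" using D(1)[OF that] by simp
  qed
  have left: "(\<lambda>us. tensor s V (us @ ys) \<phi>) \<in> multilinear_forms s V" if "ys \<in> lists V" for ys \<phi>
  proof (rule multilinear_mapsI)
    fix as bs u v c assume *: "as \<in> lists V" "bs \<in> lists V" "u \<in> V"
    then have "bs @ ys \<in> lists V" using that by simp
    note D = multilinear_mapsD[OF tensor_apply_multilinear[of s V \<phi>] *(1) this *(3)]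
    show "tensor s V ((as @ s c u # bs) @ ys) \<phi> = c * tensor s V ((as @ u # bs) @ ys) \<phi>"
      using D(2) by simp
    show "tensor s V ((as @ (u + v) # bs) @ ys) \<phi> = tensor s V ((as @ u # bs) @ ys) \<phi> + tensor s V ((as @ v # bs) @ ys) \<phi>"
      if "v \<in> V" using D(1)[OF that] by simp
  qed
  have inner: "lift (\<lambda>ys. tensor s V (us @ ys)) (tensor s V ws) = tensor s V (us @ ws)" if "us \<in> lists V" for us ws
    unfolding tensor_def by (rule lift_pure) (use right[OF that] in \<open>simp add: tensor_def\<close>)
  have "(\<lambda>us. lift (\<lambda>ys. tensor s V (us @ ys)) y \<phi>) \<in> multilinear_forms s V" for \<phi>
    using y unfolding tensor_alg_def
  proof (induction rule: fspace.span_induct_alt)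
    case base
    show ?case by (rule multilinear_mapsI) (simp_all add: lift_def)
  next
    case (step c x y)
    then obtain ws where ws: "ws \<in> lists V" "x = tensor s V ws" by auto
    have "(\<lambda>us. lift (\<lambda>ys. tensor s V (us @ ys)) x \<phi>) \<in> multilinear_forms s V"
      by (rule multilinear_forms_cong[OF V _ left[OF ws(1), of \<phi>]]) (auto simp: ws(2) inner)
    then have "(\<lambda>us. c * lift (\<lambda>ys. tensor s V (us @ ys)) x \<phi> + lift (\<lambda>ys. tensor s V (us @ ys)) y \<phi>)
        \<in> multilinear_forms s V"
      using step by (intro multilinear_forms_lincomb)
    then show "(\<lambda>us. lift (\<lambda>ys. tensor s V (us @ ys)) (fscale c x + y) \<phi>) \<in> multilinear_forms s V"
      by (simp only: lift_linear plus_fun_apply) (simp add: fscale_def)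
  qed
  then show "tensor_concat s V (tensor s V xs) y = lift (\<lambda>ys. tensor s V (xs @ ys)) y"
    unfolding tensor_concat_def by (subst (2) tensor_def, intro lift_pure)
  show "lift (\<lambda>ys. tensor s V (xs @ ys)) y \<in> tensor_alg s V"
    using y unfolding tensor_alg_def
  proof (induction rule: fspace.span_induct_alt)
    case base
    have "lift (\<lambda>ys. tensor s V (xs @ ys)) 0 = 0" by (rule ext) (simp add: lift_def)
    then show "lift (\<lambda>ys. tensor s V (xs @ ys)) 0 \<in> fspace.span (tensor s V ` lists V)"
      using fspace.span_zero by simp
  next
    case (step c x y)
    then obtain ws where ws: "ws \<in> lists V" "x = tensor s V ws" by auto
    have "tensor s V (xs @ ws) \<in> fspace.span (tensor s V ` lists V)"
      using ws(1) xs by (intro fspace.span_base) auto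
    then show "lift (\<lambda>ys. tensor s V (xs @ ys)) (fscale c x + y) \<in> fspace.span (tensor s V ` lists V)"
      using step ws(2) xs by (simp add: lift_linear inner fspace.span_add fspace.span_scale)
  qed
qed

lemma tensor_concat_closed:
  fixes s :: "'k::field \<Rightarrow> 'v::ab_group_add \<Rightarrow> 'v"
  assumes V: "\<And>u v. u \<in> V \<Longrightarrow> v \<in> V \<Longrightarrow> u + v \<in> V" "\<And>c u. u \<in> V \<Longrightarrow> s c u \<in> V"
    and x: "x \<in> tensor_alg s V" and y: "y \<in> tensor_alg s V"
  shows "tensor_concat s V x y \<in> tensor_alg s V"
  using x unfolding tensor_alg_def
proof (induction rule: fspace.span_induct_alt)
  case base
  have "tensor_concat s V 0 y = 0" by (rule ext) (simp add: tensor_concat_def lift_def)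
  then show "tensor_concat s V 0 y \<in> fspace.span (tensor s V ` lists V)"
    using fspace.span_zero by simp
next
  case (step c x x')
  then obtain xs where xs: "xs \<in> lists V" "x = tensor s V xs" by auto
  have "tensor_concat s V (fscale c x + x') y = fscale c (tensor_concat s V x y) + tensor_concat s V x' y"
    by (simp add: tensor_concat_def lift_linear)
  moreover have "tensor_concat s V x y \<in> fspace.span (tensor s V ` lists V)"
    using tensor_concat_tensor_left[OF V xs(1) y] xs(2) by (simp add: tensor_alg_def)
  ultimately show "tensor_concat s V (fscale c x + x') y \<in> fspace.span (tensor s V ` lists V)"
    using step by (simp add: fspace.span_add fspace.span_scale)
qed

section \<open>Characters\<close>

lemma TA_closed:
  "x \<in> TA s \<Longrightarrow> y \<in> TA s \<Longrightarrow> x + y \<in> TA s" "x \<in> TA s \<Longrightarrow> fscale c x \<in> TA s"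
  by (simp_all add: tensor_alg_plus_def fspace.span_add fspace.span_scale)

lemma TTA_closed:
  "x \<in> TTA s \<Longrightarrow> y \<in> TTA s \<Longrightarrow> x + y \<in> TTA s" "x \<in> TTA s \<Longrightarrow> fscale c x \<in> TTA s"
  by (simp_all add: tensor_alg_def fspace.span_add fspace.span_scale)

lemma word_in_TA: "as \<noteq> [] \<Longrightarrow> word s as \<in> TA s"
  unfolding tensor_alg_plus_def by (rule fspace.span_base) auto

text \<open>A linear property of elements of \<open>T(A)\<close> need only be checked on words.\<close>

lemma TA_induct [consumes 1, case_names zero add]:
  assumes w: "w \<in> TA s" and 0: "h 0"
    and add: "\<And>c as y. as \<noteq> [] \<Longrightarrow> y \<in> TA s \<Longrightarrow> h y \<Longrightarrow> h (fscale c (word s as) + y)"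
  shows "h w"
proof -
  have "w \<in> TA s \<and> h w"
    using w unfolding tensor_alg_plus_def
  proof (rule fspace.span_induct_alt)
    show "0 \<in> fspace.span (tensor s UNIV ` (lists UNIV - {[]})) \<and> h 0"
      using 0 fspace.span_zero by simp
  next
    fix c x y
    assume x: "x \<in> word s ` (lists UNIV - {[]})"
      and y: "y \<in> fspace.span (word s ` (lists UNIV - {[]})) \<and> h y"
    from x obtain as where as: "as \<noteq> []" "x = word s as" by auto
    have "fscale c x + y \<in> TA s"
      using word_in_TA[OF as(1), of s] y TA_closed(1,2) unfolding tensor_alg_plus_def as(2) by blast
    then show "fscale c x + y \<in> fspace.span (word s ` (lists UNIV - {[]})) \<and> h (fscale c x + y)"
      using add[OF as(1), of y c] y as(2) unfolding tensor_alg_plus_def by blast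
  qed
  then show ?thesis ..
qed

lemma bars_in_TTA: "ws \<in> lists (TA s) \<Longrightarrow> bars s ws \<in> TTA s"
  unfolding tensor_alg_def by (rule fspace.span_base) auto

lemma TA_apply_scale:
  "\<phi> \<in> multilinear_forms s UNIV \<Longrightarrow> w \<in> TA s \<Longrightarrow> w (\<lambda>as. c * \<phi> as) = c * w \<phi>"
  unfolding tensor_alg_plus_def by (rule tensor_span_apply_scale)

text \<open>The form on \<open>w\<^sub>1|\<dots>|w\<^sub>k\<close> that is the product of the values of \<open>\<psi>\<close>, extended linearly to \<open>T(A)\<close>, on the entries.
  (Elements of \<open>T(A)\<close> are themselves functionals on forms, so \<open>w \<psi>\<close> is this extension.)\<close>

definition bar_form :: "('a list \<Rightarrow> 'k) \<Rightarrow> ('a, 'k::field) TA list \<Rightarrow> 'k"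
  where "bar_form \<psi> ws = (\<Prod>w\<leftarrow>ws. w \<psi>)"

lemma bar_form_multilinear: "bar_form \<psi> \<in> multilinear_forms fscale V"
  by (rule multilinear_mapsI) (simp_all add: bar_form_def fscale_apply algebra_simps)

definition character_of :: "('k::field \<Rightarrow> 'a::ab_group_add \<Rightarrow> 'a) \<Rightarrow> ('a list \<Rightarrow> 'k) \<Rightarrow> ('a, 'k) TTA \<Rightarrow> 'k"
  where "character_of s \<psi> = restrict (\<lambda>x. x (bar_form \<psi>)) (TTA s)"

text \<open>The value \<open>1\<close> on the empty word is a convention, and not the value of \<open>\<Psi>\<close> on the bar with the single
  entry \<open>word s []\<close>, which does not belong to the double tensor algebra. It makes the subset sums
  uniform in the presence of empty gaps.\<close>

definition word_values :: "('k::field \<Rightarrow> 'a::ab_group_add \<Rightarrow> 'a) \<Rightarrow> (('a, 'k) TTA \<Rightarrow> 'k) \<Rightarrow> 'a list \<Rightarrow> 'k"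
  where "word_values s \<Psi> as = (if as = [] then 1 else \<Psi> (bars s [word s as]))"

lemma word_values_Nil [simp]: "word_values s \<Psi> [] = 1"
  by (simp add: word_values_def)

lemma evaluation_linear: "restrict (\<lambda>x. x \<phi>) (TTA s) \<in> linear_maps fscale (TTA s) (*) UNIV"
  by (auto simp: linear_maps_def TTA_closed) (simp add: fscale_apply)

lemma character_of_bars: "ws \<in> lists (TA s) \<Longrightarrow> character_of s \<psi> (bars s ws) = bar_form \<psi> ws"
  by (simp add: character_of_def bars_in_TTA tensor_apply bar_form_multilinear)

text \<open>Multiplicativity comes from \<open>bar_form \<psi> (xs @ ys) = bar_form \<psi> xs * bar_form \<psi> ys\<close>: evaluating the
  tensors \<open>y\<close> and \<open>x\<close> one after the other pulls out the two factors.\<close>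

lemma character_of_in_characters: "character_of s \<psi> \<in> characters s"
proof -
  have "x (\<lambda>xs. y (\<lambda>ys. tensor fscale (TA s) (xs @ ys) (bar_form \<psi>))) = x (bar_form \<psi>) * y (bar_form \<psi>)"
    if x: "x \<in> TTA s" and y: "y \<in> TTA s" for x y
  proof -
    note scale = tensor_span_apply_scale[OF bar_form_multilinear]
    have "tensor fscale (TA s) (xs @ ys) (bar_form \<psi>) = bar_form \<psi> xs * bar_form \<psi> ys" for xs ys
      by (simp add: tensor_apply bar_form_multilinear) (simp add: bar_form_def)
    moreover have "y (\<lambda>ys. bar_form \<psi> xs * bar_form \<psi> ys) = bar_form \<psi> xs * y (bar_form \<psi>)" for xs
      using y unfolding tensor_alg_def by (rule scale)
    moreover have "x (\<lambda>xs. y (bar_form \<psi>) * bar_form \<psi> xs) = y (bar_form \<psi>) * x (bar_form \<psi>)"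
      using x unfolding tensor_alg_def by (rule scale)
    ultimately show ?thesis by (simp add: mult.commute)
  qed
  moreover have "bar s x y \<in> TTA s" if "x \<in> TTA s" "y \<in> TTA s" for x y
    using tensor_concat_closed[OF TA_closed that] .
  ultimately show ?thesis
    unfolding characters_def
    using evaluation_linear character_of_bars[of "[]" s \<psi>]
    by (auto simp: character_of_def tensor_concat_def lift_def bar_form_def[of _ "[]"])
qed

lemma characterD:
  assumes "\<Psi> \<in> characters s"
  shows "x \<in> TTA s \<Longrightarrow> y \<in> TTA s \<Longrightarrow> \<Psi> (x + y) = \<Psi> x + \<Psi> y"
    "x \<in> TTA s \<Longrightarrow> \<Psi> (fscale c x) = c * \<Psi> x"
    "\<Psi> (TTA_one s) = 1"
    "x \<in> TTA s \<Longrightarrow> y \<in> TTA s \<Longrightarrow> \<Psi> (bar s x y) = \<Psi> x * \<Psi> y"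
  using assms by (auto simp: characters_def linear_maps_def)

lemma character_bars_Cons:
  assumes "\<Psi> \<in> characters s" "w \<in> TA s" "ws \<in> lists (TA s)"
  shows "\<Psi> (bars s (w # ws)) = \<Psi> (bars s [w]) * \<Psi> (bars s ws)"
proof -
  have "bars s (w # ws) = bar s (bars s [w]) (bars s ws)"
    by (subst tensor_concat_tensor[OF TA_closed]) (use assms in auto)
  then show ?thesis
    using characterD(4)[OF assms(1)] bars_in_TTA[of "[w]" s] bars_in_TTA[of ws s] assms by simp
qed

lemma character_entry_add:
  assumes \<Psi>: "\<Psi> \<in> characters s" and u: "u \<in> TA s" and v: "v \<in> TA s"
  shows "\<Psi> (bars s [u + v]) = \<Psi> (bars s [u]) + \<Psi> (bars s [v])"
proof -
  have "bars s [u] \<in> TTA s" "bars s [v] \<in> TTA s"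
    using u v by (auto intro: bars_in_TTA)
  moreover have "bars s [u + v] = bars s [u] + bars s [v]"
    using multilinear_mapsD(1)[OF tensor_multilinear[of fscale "TA s"], of "[]" "[]"] u v by simp
  ultimately show ?thesis
    by (simp only: characterD(1)[OF \<Psi>])
qed

lemma character_entry_scale:
  assumes \<Psi>: "\<Psi> \<in> characters s" and u: "u \<in> TA s"
  shows "\<Psi> (bars s [fscale c u]) = c * \<Psi> (bars s [u])"
proof -
  have "bars s [u] \<in> TTA s"
    using u by (auto intro: bars_in_TTA)
  moreover have "bars s [fscale c u] = fscale c (bars s [u])"
    using multilinear_mapsD(2)[OF tensor_multilinear[of fscale "TA s"], of "[]" "[]"] u by simp
  ultimately show ?thesis
    by (simp only: characterD(2)[OF \<Psi>])
qed

lemma word_values_multilinear: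
  assumes "\<Psi> \<in> characters s"
  shows "word_values s \<Psi> \<in> multilinear_forms s UNIV"
proof (rule multilinear_mapsI)
  fix xs ys :: "'a list" and u v c
  note D = multilinear_mapsD[OF tensor_multilinear[of s UNIV], of xs ys u]
  have u: "word s (xs @ u # ys) \<in> TA s" for u by (rule word_in_TA) simp
  show "word_values s \<Psi> (xs @ s c u # ys) = c * word_values s \<Psi> (xs @ u # ys)"
    using D(2)[of c] character_entry_scale[OF assms u, of c u] by (simp add: word_values_def)
  show "word_values s \<Psi> (xs @ (u + v) # ys) = word_values s \<Psi> (xs @ u # ys) + word_values s \<Psi> (xs @ v # ys)"
    using D(1)[of v] character_entry_add[OF assms u u, of u v] by (simp add: word_values_def)
qed

lemma character_singleton:
  assumes \<Psi>: "\<Psi> \<in> characters s" and w: "w \<in> TA s"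
  shows "\<Psi> (bars s [w]) = w (word_values s \<Psi>)"
  using w
proof (induction rule: TA_induct)
  case zero
  have "0 \<in> TA s" unfolding tensor_alg_plus_def by (rule fspace.span_zero)
  then show "\<Psi> (bars s [0]) = 0 (word_values s \<Psi>)"
    using character_entry_scale[OF \<Psi>, of 0 0] by simp
next
  case (add c as y)
  have "\<Psi> (bars s [word s as]) = word s as (word_values s \<Psi>)"
    using add by (simp add: tensor_apply[OF word_values_multilinear[OF \<Psi>]] word_values_def)
  moreover have "\<Psi> (bars s [fscale c (word s as) + y]) = c * \<Psi> (bars s [word s as]) + \<Psi> (bars s [y])"
    using character_entry_add[OF \<Psi> TA_closed(2)[OF word_in_TA[OF add(1)]] add(2)]
      character_entry_scale[OF \<Psi> word_in_TA[OF add(1)]] by simp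
  ultimately have "\<Psi> (bars s [fscale c (word s as) + y]) = c * word s as (word_values s \<Psi>) + y (word_values s \<Psi>)"
    using add.IH by simp
  also have "\<dots> = (fscale c (word s as) + y) (word_values s \<Psi>)"
    by (simp add: fscale_apply)
  finally show "\<Psi> (bars s [fscale c (word s as) + y]) = (fscale c (word s as) + y) (word_values s \<Psi>)" .
qed

lemma character_bars:
  assumes \<Psi>: "\<Psi> \<in> characters s" and ws: "ws \<in> lists (TA s)"
  shows "\<Psi> (bars s ws) = bar_form (word_values s \<Psi>) ws"
  using ws
proof (induction ws)
  case Nil
  then show ?case using characterD(3)[OF \<Psi>] by (simp add: bar_form_def)
next
  case (Cons w ws)
  then show ?case
    using character_bars_Cons[OF \<Psi>, of w ws] character_singleton[OF \<Psi>, of w]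
    by (simp add: bar_form_def)
qed

lemma character_of_word_values:
  assumes "\<Psi> \<in> characters s"
  shows "character_of s (word_values s \<Psi>) = \<Psi>"
proof (rule linear_maps_eqI[OF vector_space_times])
  show "character_of s (word_values s \<Psi>) \<in> linear_maps fscale (fspace.span (tensor fscale (TA s) ` lists (TA s))) (*) UNIV"
    using character_of_in_characters[of s "word_values s \<Psi>"] by (simp add: characters_def tensor_alg_def)
  show "\<Psi> \<in> linear_maps fscale (fspace.span (tensor fscale (TA s) ` lists (TA s))) (*) UNIV"
    using assms by (simp add: characters_def tensor_alg_def)
next
  fix x assume "x \<in> bars s ` lists (TA s)"
  then obtain ws where ws: "ws \<in> lists (TA s)" and x: "x = bars s ws" by blast
  show "character_of s (word_values s \<Psi>) x = \<Psi> x"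
    unfolding x character_of_bars[OF ws] character_bars[OF assms ws] ..
qed

lemma word_values_character_of:
  assumes "\<psi> \<in> multilinear_forms s UNIV" "\<psi> [] = 1"
  shows "word_values s (character_of s \<psi>) = \<psi>"
proof
  fix as show "word_values s (character_of s \<psi>) as = \<psi> as"
    using character_of_bars[of "[word s as]" s \<psi>] word_in_TA[of "as" s] assms
    by (auto simp: word_values_def bar_form_def tensor_apply)
qed

lemma nths_eq_Nil_iff: "S \<subseteq> {..<length as} \<Longrightarrow> nths as S = [] \<longleftrightarrow> S = {}"
  by (auto simp: set_nths simp flip: set_empty)

lemma nths_component_nonempty: "J \<in> components ({..<length as} - S) \<Longrightarrow> nths as J \<noteq> []"
  using nths_eq_Nil_iff[of J "as"] by (auto simp: components_def)

lemma remaining_word_list_in_TA: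
  "map (\<lambda>J. word s (nths as J)) (component_list ({..<length as} - S)) \<in> lists (TA s)"
  by (auto simp: set_component_list intro!: word_in_TA nths_component_nonempty)

lemma remaining_words_in_TTA: "remaining_words s as S \<in> TTA s"
  unfolding remaining_words_def by (intro bars_in_TTA remaining_word_list_in_TA)

lemma character_remaining_words:
  assumes \<Psi>: "\<Psi> \<in> characters s"
  shows "\<Psi> (remaining_words s as S) = gap_prod (word_values s \<Psi>) as ({..<length as} - S)"
proof -
  let ?X = "{..<length as} - S"
  have "\<Psi> (remaining_words s as S)
      = (\<Prod>J\<leftarrow>component_list ?X. word s (nths as J) (word_values s \<Psi>))"
    unfolding remaining_words_def character_bars[OF \<Psi> remaining_word_list_in_TA]
    by (simp add: bar_form_def comp_def)
  also have "\<dots> = (\<Prod>J\<in>components ?X. word s (nths as J) (word_values s \<Psi>))"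
    by (rule prod_list_component_list) simp
  finally show ?thesis
    by (simp add: gap_prod_def tensor_apply[OF word_values_multilinear[OF \<Psi>]])
qed

lemma character_subword:
  assumes \<Psi>: "\<Psi> \<in> characters s" and S: "S \<subseteq> {..<length as}"
  shows "\<Psi> (subword s as S) = word_values s \<Psi> (nths as S)"
  using characterD(3)[OF \<Psi>] nths_eq_Nil_iff[OF S] by (simp add: subword_def word_values_def)

lemma subword_in_TTA: "S \<subseteq> {..<length as} \<Longrightarrow> subword s as S \<in> TTA s"
  using nths_eq_Nil_iff[of S "as"]
  by (auto simp: subword_def intro!: bars_in_TTA word_in_TA)

section \<open>The group of characters\<close>

text \<open>The factor \<open>c\<close> and the restriction to arguments in the double tensor algebra make this lemma and
  the next two usable for the forms that occur inside the componentwise product on the tensor square;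
  these are scalar multiples of \<open>\<Psi> \<otimes> \<Phi>\<close> on such arguments only.\<close>

lemma TTA_pair_apply:
  assumes \<Psi>: "\<Psi> \<in> characters s" and \<Phi>: "\<Phi> \<in> characters s"
    and \<beta>: "\<And>u v. u \<in> TTA s \<Longrightarrow> v \<in> TTA s \<Longrightarrow> \<beta> (u, v) = c * (\<Psi> u * \<Phi> v)"
    and uv: "u \<in> TTA s" "v \<in> TTA s"
  shows "TTA_pair s (u, v) \<beta> = c * (\<Psi> u * \<Phi> v)"
proof -
  have "\<beta> \<in> bilinear_maps fscale (TTA s) fscale (TTA s) (*)"
    by (auto simp: bilinear_maps_def \<beta> TTA_closed characterD[OF \<Psi>] characterD[OF \<Phi>] algebra_simps)
  then show ?thesis
    using \<beta> uv by (simp add: tensor2_def pure_def)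
qed

lemma coproduct_word_apply:
  assumes \<Psi>: "\<Psi> \<in> characters s" and \<Phi>: "\<Phi> \<in> characters s"
    and \<beta>: "\<And>u v. u \<in> TTA s \<Longrightarrow> v \<in> TTA s \<Longrightarrow> \<beta> (u, v) = c * (\<Psi> u * \<Phi> v)"
  shows "coproduct_word s as \<beta> = c * gap_conv (word_values s \<Psi>) (word_values s \<Phi>) as"
proof -
  have "coproduct_word s as \<beta> =
      (\<Sum>S\<in>Pow {..<length as}. c * (\<Psi> (subword s as S) * \<Phi> (remaining_words s as S)))"
    unfolding coproduct_word_def sum_fun_apply
    by (rule sum.cong[OF refl], rule TTA_pair_apply[OF \<Psi> \<Phi> \<beta>])
      (auto intro: subword_in_TTA remaining_words_in_TTA)
  also have "\<dots> = c * gap_conv (word_values s \<Psi>) (word_values s \<Phi>) as"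
    unfolding sum_distrib_left[symmetric] character_remaining_words[OF \<Phi>]
      gap_conv_eq_sum_subsets[of "word_values s \<Phi>", OF word_values_Nil, symmetric]
    by (simp add: character_subword[OF \<Psi>])
  finally show ?thesis .
qed

text \<open>\<open>\<Psi> \<otimes> \<Phi>\<close> is multiplicative because \<open>\<Psi>\<close> and \<open>\<Phi>\<close> are, so its value on \<open>\<Delta>(w\<^sub>1)\<cdots>\<Delta>(w\<^sub>k)\<close> is the product of its
  values on the factors. The scalar \<open>c\<close> is general because each induction step moves the values on one
  factor into it.\<close>

lemma coproduct_bars_apply:
  assumes \<Psi>: "\<Psi> \<in> characters s" and \<Phi>: "\<Phi> \<in> characters s"
    and \<beta>: "\<And>u v. u \<in> TTA s \<Longrightarrow> v \<in> TTA s \<Longrightarrow> \<beta> (u, v) = c * (\<Psi> u * \<Phi> v)"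
    and ws: "ws \<in> lists (TA s)"
  shows "foldr (TTA_pair_mult s) (map (lift (coproduct_word s)) ws) (TTA_pair s (TTA_one s, TTA_one s)) \<beta> =
    c * bar_form (gap_conv (word_values s \<Psi>) (word_values s \<Phi>)) ws"
  using ws \<beta>
proof (induction ws arbitrary: c \<beta>)
  case Nil
  have one: "TTA_one s \<in> TTA s" by (rule bars_in_TTA) simp
  have "TTA_pair s (TTA_one s, TTA_one s) \<beta> = c * (\<Psi> (TTA_one s) * \<Phi> (TTA_one s))"
    by (rule TTA_pair_apply[OF \<Psi> \<Phi> _ one one]) (rule Nil)
  then show ?case
    unfolding characterD(3)[OF \<Psi>] characterD(3)[OF \<Phi>] by (simp add: bar_form_def)
next
  case (Cons w ws)
  let ?K = "gap_conv (word_values s \<Psi>) (word_values s \<Phi>)"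
  let ?Y = "foldr (TTA_pair_mult s) (map (lift (coproduct_word s)) ws) (TTA_pair s (TTA_one s, TTA_one s))"
  \<comment> \<open>The form that the first factor \<open>\<Delta>(w)\<close> sees after all other factors have been evaluated.\<close>
  define \<gamma> where "\<gamma> = (\<lambda>(x, y). ?Y (\<lambda>(x', y'). TTA_pair s (bar s x x', bar s y y') \<beta>))"
  have bar_closed: "bar s x y \<in> TTA s" if "x \<in> TTA s" "y \<in> TTA s" for x y
    using tensor_concat_closed[OF TA_closed that] .
  have \<gamma>: "\<gamma> (x, y) = (c * bar_form ?K ws) * (\<Psi> x * \<Phi> y)" if xy: "x \<in> TTA s" "y \<in> TTA s" for x y
  proof -
    have "?Y (\<lambda>(x', y'). TTA_pair s (bar s x x', bar s y y') \<beta>) = (c * (\<Psi> x * \<Phi> y)) * bar_form ?K ws"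
    proof (rule Cons.IH)
      fix u v assume uv: "u \<in> TTA s" "v \<in> TTA s"
      have "TTA_pair s (bar s x u, bar s y v) \<beta> = c * (\<Psi> (bar s x u) * \<Phi> (bar s y v))"
        using uv xy by (intro TTA_pair_apply[OF \<Psi> \<Phi> Cons.prems] bar_closed)
      then show "(\<lambda>(x', y'). TTA_pair s (bar s x x', bar s y y') \<beta>) (u, v) = c * (\<Psi> x * \<Phi> y) * (\<Psi> u * \<Phi> v)"
        using characterD(4)[OF \<Psi> xy(1) uv(1)] characterD(4)[OF \<Phi> xy(2) uv(2)] by simp
    qed
    then show ?thesis by (simp add: \<gamma>_def)
  qed
  have "coproduct_word s as \<gamma> = (c * bar_form ?K ws) * ?K as" for as
    by (rule coproduct_word_apply[OF \<Psi> \<Phi>]) (rule \<gamma>)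
  moreover have "TTA_pair_mult s (lift (coproduct_word s) w) ?Y \<beta> = w (\<lambda>as. coproduct_word s as \<gamma>)"
    by (simp add: \<gamma>_def TTA_pair_mult_def lift_def case_prod_unfold)
  ultimately have "TTA_pair_mult s (lift (coproduct_word s) w) ?Y \<beta> = w (\<lambda>as. (c * bar_form ?K ws) * ?K as)"
    by simp
  also have "\<dots> = (c * bar_form ?K ws) * w ?K"
    using Cons.hyps by (intro TA_apply_scale[of _ s] gap_conv_multilinear word_values_multilinear \<Psi> \<Phi>) auto
  finally show ?case
    by (simp add: bar_form_def)
qed

lemma convolution_eq_character_of:
  assumes \<Psi>: "\<Psi> \<in> characters s" and \<Phi>: "\<Phi> \<in> characters s"
  shows "convolution s \<Psi> \<Phi> = character_of s (gap_conv (word_values s \<Psi>) (word_values s \<Phi>))"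
proof -
  have "coproduct s x (\<lambda>(u, v). \<Psi> u * \<Phi> v) = x (bar_form (gap_conv (word_values s \<Psi>) (word_values s \<Phi>)))"
    if "x \<in> TTA s" for x
    unfolding coproduct_def lift_def
  proof (rule tensor_alg_apply_cong[OF TA_closed _ that])
    fix ws assume "ws \<in> lists (TA s)"
    from coproduct_bars_apply[OF \<Psi> \<Phi> _ this, of "\<lambda>(u, v). \<Psi> u * \<Phi> v" 1]
    show "foldr (TTA_pair_mult s) (map (\<lambda>t x. t (\<lambda>p. coproduct_word s p x)) ws) (TTA_pair s (TTA_one s, TTA_one s))
        (\<lambda>(u, v). \<Psi> u * \<Phi> v) = bar_form (gap_conv (word_values s \<Psi>) (word_values s \<Phi>)) ws"
      by (simp add: lift_def[abs_def])
  qed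
  then show ?thesis
    unfolding convolution_def character_of_def by (intro restrict_ext)
qed

lemma counit_eq_character_of: "counit s = character_of s unit_word"
proof -
  have zero: "w unit_word = 0" if "w \<in> TA s" for w
    using that
  proof (induction rule: TA_induct)
    case (add c as y)
    then show ?case
      by (simp add: fscale_apply tensor_apply[OF unit_word_multilinear]) (simp add: unit_word_def)
  qed simp
  have "x (\<lambda>ws. if ws = [] then 1 else 0) = x (bar_form unit_word)" if "x \<in> TTA s" for x
  proof (rule tensor_alg_apply_cong[OF TA_closed _ that])
    fix ws assume ws: "ws \<in> lists (TA s)"
    then show "(if ws = [] then 1 else 0) = bar_form unit_word ws"
      by (cases ws) (simp_all add: bar_form_def zero)
  qed
  then show ?thesis
    unfolding counit_def character_of_def by (intro restrict_ext)
qed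

lemma word_values_convolution:
  assumes "\<Psi> \<in> characters s" "\<Phi> \<in> characters s"
  shows "word_values s (convolution s \<Psi> \<Phi>) = gap_conv (word_values s \<Psi>) (word_values s \<Phi>)"
  unfolding convolution_eq_character_of[OF assms]
  by (rule word_values_character_of)
    (simp_all add: gap_conv_multilinear word_values_multilinear assms, simp add: gap_conv_def cauchy_prod_Nil)

lemma word_values_counit: "word_values s (counit s) = unit_word"
  unfolding counit_eq_character_of
  by (rule word_values_character_of[OF unit_word_multilinear]) (simp add: unit_word_def)

lemma group_character_group: "group (character_group s)"
proof (rule groupI)
  have one: "\<one>\<^bsub>character_group s\<^esub> = counit s" and mult: "\<And>x y. x \<otimes>\<^bsub>character_group s\<^esub> y = convolution s x y"
    and car: "carrier (character_group s) = characters s"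
    by (simp_all add: character_group_def)
  have closed: "convolution s \<Psi> \<Phi> \<in> characters s" if "\<Psi> \<in> characters s" "\<Phi> \<in> characters s" for \<Psi> \<Phi>
    using that by (simp add: convolution_eq_character_of character_of_in_characters)
  have unit: "counit s \<in> characters s"
    by (simp add: counit_eq_character_of character_of_in_characters)
  show "\<one>\<^bsub>character_group s\<^esub> \<in> carrier (character_group s)"
    by (simp add: one car unit)
  fix x assume x: "x \<in> carrier (character_group s)"
  then have x': "x \<in> characters s" by (simp add: car)
  show "\<one>\<^bsub>character_group s\<^esub> \<otimes>\<^bsub>character_group s\<^esub> x = x"
    using x' unit
    by (simp add: one mult convolution_eq_character_of word_values_counit gap_conv_unit_left character_of_word_values)
  show "\<exists>y\<in>carrier (character_group s). y \<otimes>\<^bsub>character_group s\<^esub> x = \<one>\<^bsub>character_group s\<^esub>"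
  proof -
    obtain \<chi> where \<chi>: "\<chi> \<in> multilinear_forms s UNIV" "\<chi> [] = 1"
        "gap_conv \<chi> (word_values s x) = unit_word"
      using gap_conv_left_inverse[OF word_values_multilinear[OF x'] word_values_Nil] .
    have "convolution s (character_of s \<chi>) x = counit s"
      using x' by (simp add: convolution_eq_character_of character_of_in_characters word_values_character_of \<chi> counit_eq_character_of)
    then show ?thesis
      using character_of_in_characters by (auto simp: car mult one)
  qed
  fix y assume y: "y \<in> carrier (character_group s)"
  then show "x \<otimes>\<^bsub>character_group s\<^esub> y \<in> carrier (character_group s)"
    using x by (simp add: car mult closed)
  fix z assume z: "z \<in> carrier (character_group s)"
  show "x \<otimes>\<^bsub>character_group s\<^esub> y \<otimes>\<^bsub>character_group s\<^esub> z =
      x \<otimes>\<^bsub>character_group s\<^esub> (y \<otimes>\<^bsub>character_group s\<^esub> z)"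
    using x y z unfolding car mult
    by (simp add: convolution_eq_character_of[of "convolution s x y" s z] convolution_eq_character_of[of x s "convolution s y z"]
        closed word_values_convolution gap_conv_assoc)
qed

section \<open>The operation on endomorphisms\<close>

text \<open>The map \<open>L\<close> takes values in \<open>T(A)\<close>, whose elements are functions; evaluating them at \<open>\<xi>\<close> makes a scalar
  function on words. Since \<open>T(A)\<close> does not contain the empty word, the value there is free; with \<open>0\<close>
  the sum over the subsets that contain the first position, which is empty for the empty word, is
  still the substituted series.\<close>

definition word_coordinate ::
  "('k::field \<Rightarrow> 'a::ab_group_add \<Rightarrow> 'a) \<Rightarrow> (('a, 'k) TA \<Rightarrow> ('a, 'k) TA) \<Rightarrow> ('a list \<Rightarrow> 'k) \<Rightarrow> 'a list \<Rightarrow> 'k"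
  where "word_coordinate s L \<xi> as = (if as = [] then 0 else L (word s as) \<xi>)"

lemma word_coordinate_multilinear:
  assumes L: "L \<in> End_TA s"
  shows "word_coordinate s L \<xi> \<in> multilinear_forms s UNIV"
proof (rule multilinear_mapsI)
  fix xs ys :: "'a list" and u v c
  note D = multilinear_mapsD[OF tensor_multilinear[of s UNIV], of xs ys u]
  have w: "word s (xs @ u # ys) \<in> TA s" for u by (rule word_in_TA) simp
  show "word_coordinate s L \<xi> (xs @ s c u # ys) = c * word_coordinate s L \<xi> (xs @ u # ys)"
    using D(2)[of c] linear_mapsD(3)[OF L w, of c u]
    by (simp add: word_coordinate_def) (simp add: fscale_apply)
  show "word_coordinate s L \<xi> (xs @ (u + v) # ys) = word_coordinate s L \<xi> (xs @ u # ys) + word_coordinate s L \<xi> (xs @ v # ys)"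
    using D(1)[of v] linear_mapsD(2)[OF L w w, of u v] by (simp add: word_coordinate_def)
qed

lemma char_act_apply:
  assumes \<Psi>: "\<Psi> \<in> characters s" and L: "L \<in> End_TA s" and x: "x \<in> TA s"
  shows "char_act s \<Psi> L x \<xi> = x (gap_subst (word_coordinate s L \<xi>) (word_values s \<Psi>))"
proof -
  let ?\<beta> = "\<lambda>(u, h). \<Psi> h * L u \<xi>"
  have "?\<beta> \<in> bilinear_maps fscale (TA s) fscale (TTA s) (*)"
    by (auto simp: bilinear_maps_def characterD[OF \<Psi>] linear_mapsD(2,3)[OF L] fscale_apply algebra_simps)
  then have term_apply: "tensor2 fscale (TA s) fscale (TTA s) p ?\<beta> = ?\<beta> p" for p
    by (simp add: tensor2_def pure_def)
  have "(\<Sum>S\<in>{S \<in> Pow {..<length as}. 0 \<in> S}. \<Psi> (remaining_words s as S) * L (word s (nths as S)) \<xi>) =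
      gap_subst (word_coordinate s L \<xi>) (word_values s \<Psi>) as" for as
  proof (cases "as = []")
    case True
    then have "{S \<in> Pow {..<length as}. 0 \<in> S} = {}" by auto
    with True show ?thesis by (simp only: sum.empty gap_subst.simps(1)) (simp add: word_coordinate_def)
  next
    case False
    have "\<Psi> (remaining_words s as S) * L (word s (nths as S)) \<xi> =
        word_coordinate s L \<xi> (nths as S) * gap_prod (word_values s \<Psi>) as ({..<length as} - S)"
      if "S \<in> {S \<in> Pow {..<length as}. 0 \<in> S}" for S
      using that nths_eq_Nil_iff[of S "as"]
      by (auto simp: character_remaining_words[OF \<Psi>] word_coordinate_def)
    then show ?thesis
      using gap_subst_eq_sum_subsets[of "word_values s \<Psi>" "as" "word_coordinate s L \<xi>"] False
      by simp
  qed
  moreover have "char_act s \<Psi> L x \<xi> = x (\<lambda>as.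
      \<Sum>S\<in>{S \<in> Pow {..<length as}. 0 \<in> S}. \<Psi> (remaining_words s as S) * L (word s (nths as S)) \<xi>)"
    using x by (simp add: char_act_def left_half_coproduct_def lift_def case_prod_unfold fscale_apply
        sum_fun_apply term_apply[unfolded case_prod_unfold])
  ultimately show ?thesis by simp
qed

lemma char_act_word:
  assumes \<Psi>: "\<Psi> \<in> characters s" and L: "L \<in> End_TA s" and as: "as \<noteq> []"
  shows "char_act s \<Psi> L (word s as) \<xi> = gap_subst (word_coordinate s L \<xi>) (word_values s \<Psi>) as"
  unfolding char_act_apply[OF \<Psi> L word_in_TA[OF as]]
  by (intro tensor_apply gap_subst_multilinear word_coordinate_multilinear L word_values_multilinear \<Psi>)

lemma word_coordinate_char_act:
  assumes \<Psi>: "\<Psi> \<in> characters s" and L: "L \<in> End_TA s"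
  shows "word_coordinate s (char_act s \<Psi> L) \<xi> = gap_subst (word_coordinate s L \<xi>) (word_values s \<Psi>)"
proof
  fix as show "word_coordinate s (char_act s \<Psi> L) \<xi> as = gap_subst (word_coordinate s L \<xi>) (word_values s \<Psi>) as"
    using char_act_word[OF \<Psi> L, of "as" \<xi>]
    by (cases "as = []") (simp_all add: word_coordinate_def[of s "char_act s \<Psi> L"], simp add: word_coordinate_def)
qed

lemma End_TA_eqI:
  assumes "L \<in> End_TA s" "M \<in> End_TA s" "\<And>as \<xi>. as \<noteq> [] \<Longrightarrow> L (word s as) \<xi> = M (word s as) \<xi>"
  shows "L = M"
proof (rule linear_maps_eqI[OF vector_space_fscale])
  show "L \<in> linear_maps fscale (fspace.span (tensor s UNIV ` (lists UNIV - {[]}))) fscale (TA s)"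
    "M \<in> linear_maps fscale (fspace.span (tensor s UNIV ` (lists UNIV - {[]}))) fscale (TA s)"
    using assms(1,2) by (simp_all add: tensor_alg_plus_def)
qed (auto intro: ext assms(3))

text \<open>Linearity is visible in \<open>char_act_apply\<close>. That the values lie in \<open>T(A)\<close> cannot be read off from their
  coordinates; on words it follows from the expression as a finite linear combination of values of
  \<open>L\<close>.\<close>

lemma char_act_closed:
  fixes s :: "'k::field \<Rightarrow> 'a::ab_group_add \<Rightarrow> 'a"
  assumes \<Psi>: "\<Psi> \<in> characters s" and L: "L \<in> End_TA s"
  shows "char_act s \<Psi> L \<in> End_TA s"
proof -
  define T where "T x \<xi> = x (gap_subst (word_coordinate s L \<xi>) (word_values s \<Psi>))" for x :: "('a, 'k) TA" and \<xi>
  have T_add: "T (x + y) = T x + T y" and T_scale: "T (fscale c x) = fscale c (T x)" for x y c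
    by (simp_all add: T_def fun_eq_iff fscale_apply)
  have T_eq: "char_act s \<Psi> L x = T x" if "x \<in> TA s" for x
    by (rule ext) (simp add: char_act_apply[OF \<Psi> L that] T_def)
  have T_word: "T (word s as) \<in> TA s" if as: "as \<noteq> []" for as
  proof -
    have "T (word s as) = (\<Sum>S\<in>{S \<in> Pow {..<length as}. 0 \<in> S}.
        fscale (gap_prod (word_values s \<Psi>) as ({..<length as} - S)) (L (word s (nths as S))))"
    proof
      fix \<xi>
      have "T (word s as) \<xi> = gap_subst (word_coordinate s L \<xi>) (word_values s \<Psi>) as"
        using char_act_word[OF \<Psi> L as] T_eq[OF word_in_TA[OF as]] by simp
      also have "\<dots> = (\<Sum>S\<in>{S \<in> Pow {..<length as}. 0 \<in> S}.
          word_coordinate s L \<xi> (nths as S) * gap_prod (word_values s \<Psi>) as ({..<length as} - S))"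
        by (rule gap_subst_eq_sum_subsets[symmetric]) (simp_all add: as)
      finally show "T (word s as) \<xi> = (\<Sum>S\<in>{S \<in> Pow {..<length as}. 0 \<in> S}.
          fscale (gap_prod (word_values s \<Psi>) as ({..<length as} - S)) (L (word s (nths as S)))) \<xi>"
        using nths_eq_Nil_iff[of _ "as"]
        by (auto simp: sum_fun_apply fscale_apply word_coordinate_def intro!: sum.cong)
    qed
    also have "\<dots> \<in> TA s"
      unfolding tensor_alg_plus_def
    proof (intro fspace.span_sum fspace.span_scale)
      fix S assume "S \<in> {S \<in> Pow {..<length as}. 0 \<in> S}"
      then have "nths as S \<noteq> []" using nths_eq_Nil_iff[of S "as"] by auto
      then show "L (word s (nths as S)) \<in> fspace.span (word s ` (lists UNIV - {[]}))"
        using linear_mapsD(1)[OF L word_in_TA] by (simp add: tensor_alg_plus_def)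
    qed
    finally show ?thesis .
  qed
  have "T x \<in> TA s" if "x \<in> TA s" for x
    using that
  proof (induction rule: TA_induct)
    case zero
    have "T 0 = 0" by (rule ext) (simp add: T_def)
    then show "T 0 \<in> TA s"
      using fspace.span_zero by (simp add: tensor_alg_plus_def)
  next
    case (add c as y)
    then show "T (fscale c (word s as) + y) \<in> TA s"
      unfolding T_add T_scale by (intro TA_closed T_word)
  qed
  then show ?thesis
    by (auto simp: linear_maps_def T_eq TA_closed T_add T_scale) (simp add: char_act_def)
qed

theorem proposition8p2:
  fixes scale :: "'k::field_char_0 \<Rightarrow> 'a::{ring,monoid_mult} \<Rightarrow> 'a"
  assumes "unital_algebra scale"
  shows "right_group_action (character_group scale) (End_TA scale) (char_act scale)"
proof -
  interpret group "character_group scale" by (rule group_character_group)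
  have car: "carrier (character_group scale) = characters scale"
    and one: "\<one>\<^bsub>character_group scale\<^esub> = counit scale"
    and mult: "\<And>x y. x \<otimes>\<^bsub>character_group scale\<^esub> y = convolution scale x y"
    by (simp_all add: character_group_def)
  show ?thesis
  proof
    fix \<Psi> L assume "\<Psi> \<in> carrier (character_group scale)" and L: "L \<in> End_TA scale"
    then show "char_act scale \<Psi> L \<in> End_TA scale"
      by (intro char_act_closed) (simp_all add: car)
  next
    fix L assume L: "L \<in> End_TA scale"
    have unit: "counit scale \<in> characters scale"
      using one_closed by (simp add: car one)
    show "char_act scale \<one>\<^bsub>character_group scale\<^esub> L = L"
      unfolding one
    proof (rule End_TA_eqI[OF char_act_closed[OF unit L] L])
      fix as :: "'a list" and \<xi> assume "as \<noteq> []"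
      then show "char_act scale (counit scale) L (word scale as) \<xi> = L (word scale as) \<xi>"
        by (simp add: char_act_word[OF unit L] word_values_counit gap_subst_unit_right word_coordinate_def)
    qed
  next
    fix \<Psi> \<Phi> L
    assume "\<Psi> \<in> carrier (character_group scale)" "\<Phi> \<in> carrier (character_group scale)" and L: "L \<in> End_TA scale"
    then have \<Psi>: "\<Psi> \<in> characters scale" and \<Phi>: "\<Phi> \<in> characters scale"
      and prod: "convolution scale \<Psi> \<Phi> \<in> characters scale"
      using m_closed[of \<Psi> \<Phi>] by (simp_all add: car mult)
    note L\<Psi> = char_act_closed[OF \<Psi> L]
    show "char_act scale (\<Psi> \<otimes>\<^bsub>character_group scale\<^esub> \<Phi>) L = char_act scale \<Phi> (char_act scale \<Psi> L)"
      unfolding mult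
    proof (rule End_TA_eqI[OF char_act_closed[OF prod L] char_act_closed[OF \<Phi> L\<Psi>]])
      fix as :: "'a list" and \<xi> assume as: "as \<noteq> []"
      show "char_act scale (convolution scale \<Psi> \<Phi>) L (word scale as) \<xi> =
          char_act scale \<Phi> (char_act scale \<Psi> L) (word scale as) \<xi>"
        by (simp add: char_act_word[OF prod L as] char_act_word[OF \<Phi> L\<Psi> as]
            word_values_convolution[OF \<Psi> \<Phi>] word_coordinate_char_act[OF \<Psi> L] gap_subst_gap_subst)
    qed
  qed
qed

end
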